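(* There is a continuous map $\mathit{Trees}\ni T\mapsto(\Phi_1(T),\Phi_2(T))\in\operatorname{Min}(\mathcal C)^2$ such that, for every $T\in\mathit{Trees}$: if $T$ is ill-founded, then $\Phi_1(T)\cong\Phi_2(T)$; and if $T$ is well-founded, then $\Phi_1(T)\not\cong\Phi_2(T)$ and $\Phi_1(T)\not\cong\Phi_2(T)^{-1}$.
   Context: $\mathbb N=\{1,2,\dots\}$. $\mathcal C=\{0,1\}^{\mathbb N}$ is the Cantor set with the product topology. $\operatorname{Homeo}(\mathcal C)$ is its homeomorphism group with the topology of uniform convergence (a Polish group). $\operatorname{Min}(\mathcal C)\subseteq\operatorname{Homeo}(\mathcal C)$, with the subspace topology, is the set of homeomorphisms $U$ such that every orbit $\{U^n x:n\in\mathbb Z\}$ is dense (minimal homeomorphisms). For $U,V\in\operatorname{Homeo}(\mathcal C)$, $U\cong V$ means that there is $\varphi\in\operatorname{Homeo}(\mathcal C)$ with $\varphi\circ U=V\circ\varphi$. $\mathbb N^{<\mathbb N}$ is the set of finite words over $\mathbb N$ (including the empty word). A tree is a nonempty set $T\subseteq\mathbb N^{<\mathbb N}$ closed under taking prefixes. $\mathit{Trees}$ is the set of trees of unbounded depth, i.e. trees containing a word of length $j$ for every $j\ge0$, with the subspace topology inherited from the product space $2^{\mathbb N^{<\mathbb N}}$ by identifying a tree with its characteristic function (this is a Polish space). A tree is ill-founded if it has an infinite branch, i.e. there is $w\in\mathbb N^{\mathbb N}$ all of whose finite prefixes belong to $T$; otherwise it is well-founded. *)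

theory Defs
  imports "HOL-Analysis.Analysis" "HOL-Library.Sublist"
begin

text \<open>
  The discrete metric on \<^typ>\<open>bool\<close>. It induces the (discrete) topology that \<^typ>\<open>bool\<close> already
  carries in the library, and it makes \<open>nat \<Rightarrow> bool\<close>, with its product topology, an instance of
  \<^class>\<open>metric_space\<close> via the library's metric on countable products.
\<close>

instantiation bool :: metric_space
begin

definition dist_bool :: "bool \<Rightarrow> bool \<Rightarrow> real"
  where "dist_bool a b = of_bool (a \<noteq> b)"

definition uniformity_bool :: "(bool \<times> bool) filter"
  where "uniformity_bool = (INF e\<in>{0<..}. principal {(a, b). dist a b < e})"

instance
proof
  fix U :: "bool set"
  have "\<forall>\<^sub>F (x', y) in uniformity. x' = x \<longrightarrow> y \<in> U" if "x \<in> U" for x :: bool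
    unfolding uniformity_bool_def
    by (rule eventually_INF1[of 1]) (use that in \<open>auto simp: eventually_principal dist_bool_def\<close>)
  then show "open U = (\<forall>x\<in>U. \<forall>\<^sub>F (x', y) in uniformity. x' = x \<longrightarrow> y \<in> U)"
    by (simp add: open_discrete)
qed (auto simp: dist_bool_def uniformity_bool_def)

end

text \<open>
  The coordinates of a point of the Cantor set and the letters of a word range over
  \<open>{0, 1, 2, \<dots>}\<close> instead of \<open>{1, 2, \<dots>}\<close>; this is only a renaming.
\<close>

type_synonym cantor = "nat \<Rightarrow> bool"

definition Homeo :: "(cantor \<Rightarrow> cantor) set"
  where "Homeo = {U. \<exists>V. homeomorphism UNIV UNIV U V}"

definition sup_dist :: "(cantor \<Rightarrow> cantor) \<Rightarrow> (cantor \<Rightarrow> cantor) \<Rightarrow> real"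
  where "sup_dist U V = (SUP x. dist (U x) (V x))"

lemma dist_cantor_le: "dist (x :: cantor) y \<le> 2"
proof -
  have "dist x y \<le> (\<Sum>n. (1 / 2) ^ n)"
    unfolding dist_fun_def
  proof (rule suminf_le)
    show "summable (\<lambda>n. (1 / 2 :: real) ^ n)"
      by (simp add: summable_geometric_iff)
    then show "summable (\<lambda>n. (1 / 2) ^ n * min (dist (x (from_nat n)) (y (from_nat n))) 1)"
      by (rule summable_comparison_test'[where N = 0]) simp
  qed simp
  then show ?thesis
    by (simp add: suminf_geometric)
qed

lemma bdd_above_dist_cantor: "bdd_above (range (\<lambda>x. dist (U x :: cantor) (V x)))"
  by (intro bdd_aboveI[of _ 2]) (auto intro: dist_cantor_le)

lemma dist_le_sup_dist: "dist (U x) (V x) \<le> sup_dist U V"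
  unfolding sup_dist_def by (intro cSUP_upper bdd_above_dist_cantor) simp

lemma Metric_space_Homeo: "Metric_space Homeo sup_dist"
proof
  fix U V W :: "cantor \<Rightarrow> cantor"
  show "0 \<le> sup_dist U V"
    using dist_le_sup_dist[of U undefined V] by (meson order_trans zero_le_dist)
  show "sup_dist U V = sup_dist V U"
    by (simp add: sup_dist_def dist_commute)
  show "sup_dist U V = 0 \<longleftrightarrow> U = V"
  proof
    assume "sup_dist U V = 0"
    then have "dist (U x) (V x) \<le> 0" for x
      using dist_le_sup_dist[of U x V] by simp
    then show "U = V" by auto
  qed (simp add: sup_dist_def)
  show "sup_dist U W \<le> sup_dist U V + sup_dist V W"
    unfolding sup_dist_def[of U W]
  proof (rule cSUP_least)
    fix x
    show "dist (U x) (W x) \<le> sup_dist U V + sup_dist V W"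
      using dist_triangle[of "U x" "W x" "V x"] dist_le_sup_dist[of U x V] dist_le_sup_dist[of V x W]
      by linarith
  qed simp
qed

definition homeo_topology :: "(cantor \<Rightarrow> cantor) topology"
  where "homeo_topology = Metric_space.mtopology Homeo sup_dist"

lemma topspace_homeo_topology [simp]: "topspace homeo_topology = Homeo"
  by (simp add: homeo_topology_def Metric_space.topspace_mtopology[OF Metric_space_Homeo])

lemma limitin_homeo_topology_iff:
  "limitin homeo_topology f U F \<longleftrightarrow>
     U \<in> Homeo \<and> (\<forall>\<^sub>F i in F. f i \<in> Homeo) \<and> uniform_limit UNIV f U F"
proof -
  have 1: "\<forall>\<^sub>F i in F. sup_dist (f i) U < e"
    if "0 < e" "uniform_limit UNIV f U F" for e
  proof -
    have "\<forall>\<^sub>F i in F. \<forall>x\<in>UNIV. dist (f i x) (U x) < e / 2"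
      using that by (intro uniform_limitD) auto
    then show ?thesis
    proof (rule eventually_mono)
      fix i assume "\<forall>x\<in>UNIV. dist (f i x) (U x) < e / 2"
      then have "sup_dist (f i) U \<le> e / 2"
        unfolding sup_dist_def by (intro cSUP_least) (auto intro: less_imp_le)
      then show "sup_dist (f i) U < e" using that by simp
    qed
  qed
  have 2: "uniform_limit UNIV f U F" if "\<And>e. 0 < e \<Longrightarrow> \<forall>\<^sub>F i in F. sup_dist (f i) U < e"
    by (rule uniform_limitI, rule eventually_mono[OF that]) (auto intro: le_less_trans[OF dist_le_sup_dist])
  show ?thesis
    unfolding homeo_topology_def Metric_space.limitin_metric[OF Metric_space_Homeo]
    unfolding eventually_conj_iff using 1 2 by (metis zero_less_one)
qed

definition int_iterate :: "('a \<Rightarrow> 'a) \<Rightarrow> int \<Rightarrow> 'a \<Rightarrow> 'a"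
  where "int_iterate U n = (if n \<ge> 0 then U ^^ nat n else inv U ^^ nat (- n))"

definition orbit :: "(cantor \<Rightarrow> cantor) \<Rightarrow> cantor \<Rightarrow> cantor set"
  where "orbit U x = {int_iterate U n x | n. True}"

definition Min_Homeo :: "(cantor \<Rightarrow> cantor) set"
  where "Min_Homeo = {U \<in> Homeo. \<forall>x. closure (orbit U x) = UNIV}"

definition min_topology :: "(cantor \<Rightarrow> cantor) topology"
  where "min_topology = subtopology homeo_topology Min_Homeo"

definition conjugate :: "(cantor \<Rightarrow> cantor) \<Rightarrow> (cantor \<Rightarrow> cantor) \<Rightarrow> bool"
  where "conjugate U V \<longleftrightarrow> (\<exists>\<phi>\<in>Homeo. \<phi> \<circ> U = V \<circ> \<phi>)"

text \<open>
  Sets of words are represented by their characteristic functions, so that the library topology on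
  \<open>nat list \<Rightarrow> bool\<close> is the product topology of \<open>2\<close> to the power of the set of words.
\<close>

definition is_tree :: "(nat list \<Rightarrow> bool) \<Rightarrow> bool"
  where "is_tree T \<longleftrightarrow> (\<exists>w. T w) \<and> (\<forall>w u. T w \<longrightarrow> prefix u w \<longrightarrow> T u)"

definition Trees :: "(nat list \<Rightarrow> bool) set"
  where "Trees = {T. is_tree T \<and> (\<forall>j. \<exists>w. T w \<and> length w = j)}"

definition ill_founded :: "(nat list \<Rightarrow> bool) \<Rightarrow> bool"
  where "ill_founded T \<longleftrightarrow> (\<exists>w :: nat \<Rightarrow> nat. \<forall>n. T (map w [0..<n]))"

abbreviation well_founded :: "(nat list \<Rightarrow> bool) \<Rightarrow> bool"
  where "well_founded T \<equiv> \<not> ill_founded T"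

end

theory Submission
  imports Defs "HOL-Number_Theory.Cong" "HOL-Computational_Algebra.Primes"
begin

text \<open>
  Every system used is a minimal almost one-to-one extension of the product \<open>K\<close> of the
  \<open>p\<^sub>j\<close>-adic odometers, given as the orbit closure of an array of Toeplitz sequences. At level \<open>n\<close>
  it splits the cosets, modulo the coordinates beyond \<open>n\<close>, of the points
  \<open>\<beta>\<^sub>n + \<Sum>x\<^sub>w (u\<^bsub>w|1\<^esub>, \<dots>, u\<^bsub>w|n\<^esub>)\<close>, where the integers \<open>x\<^sub>w\<close> are indexed by the words \<open>w\<close> of length \<open>n\<close>
  in the tree, and have sum \<open>0\<close> for the first and sum \<open>1\<close> for the second system. All the
  \<open>\<beta>\<^sub>n\<close> and \<open>u\<^sub>v\<close> are lacunary series, hence independent over the integers. A conjugacy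
  covers a rotation of \<open>K\<close> and matches the split points. Up to a power of the shift, the rotation
  is therefore given, for each \<open>n\<close>, by a combination with coefficient sum \<open>1\<close> of words of length
  \<open>n\<close> in the tree; by independence these combinations are compatible with taking prefixes, and
  following nonzero coefficients produces an infinite branch. Conversely, rotation by
  \<open>(u\<^bsub>w|j\<^esub>)\<^sub>j\<close> for a branch \<open>w\<close> is a conjugacy. A conjugacy with the inverse would cover a
  reflection of \<open>K\<close> instead, which the independence of the \<open>\<beta>\<^sub>n\<close> excludes.
\<close>

section \<open>Finite agreement of binary functions\<close>

definition agree :: "nat \<Rightarrow> ('i::countable \<Rightarrow> bool) \<Rightarrow> ('i \<Rightarrow> bool) \<Rightarrow> bool"
  where "agree n x y \<longleftrightarrow> (\<forall>i<n. x (from_nat i) = y (from_nat i))"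

lemma agree_refl [simp]: "agree n x x"
  by (simp add: agree_def)

lemma agree_sym: "agree n x y \<Longrightarrow> agree n y x"
  by (simp add: agree_def)

lemma agree_trans: "agree n x y \<Longrightarrow> agree n y z \<Longrightarrow> agree n x z"
  by (simp add: agree_def)

lemma agree_mono: "agree n x y \<Longrightarrow> m \<le> n \<Longrightarrow> agree m x y"
  by (simp add: agree_def)

lemma agree_Suc: "agree (Suc n) x y \<longleftrightarrow> agree n x y \<and> x (from_nat n) = y (from_nat n)"
  by (auto simp: agree_def less_Suc_eq)

lemma agree_imp_eq: "agree (Suc (to_nat v)) x y \<Longrightarrow> x v = y v"
  unfolding agree_def by (metis from_nat_to_nat lessI)

lemma agree_finite:
  fixes W :: "'i::countable set"
  assumes "finite W"
  shows "\<exists>n. \<forall>x y. agree n x y \<longrightarrow> (\<forall>v\<in>W. x v = y v)"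
proof -
  have "x v = y v" if "agree (Suc (Max (to_nat ` W))) x y" "v \<in> W" for x y v
  proof (rule agree_imp_eq[OF agree_mono[OF that(1)]])
    show "Suc (to_nat v) \<le> Suc (Max (to_nat ` W))"
      using assms that(2) by simp
  qed
  then show ?thesis by blast
qed

text \<open>Because \<open>Q\<close> shrinks as its index grows, the largest index settling one of
  the first \<open>n\<close> coordinates settles all of them. This lifts coordinatewise arguments to
  \<open>agree\<close>.\<close>

lemma agree_uniform:
  fixes Q :: "nat \<Rightarrow> ('i::countable \<Rightarrow> bool) \<Rightarrow> ('i \<Rightarrow> bool) \<Rightarrow> bool"
  assumes ev: "\<And>v. \<exists>R. \<forall>x y. Q R x y \<longrightarrow> x v = y v"
    and mono: "\<And>R S x y. R \<le> S \<Longrightarrow> Q S x y \<Longrightarrow> Q R x y"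
  shows "\<exists>R. \<forall>x y. Q R x y \<longrightarrow> agree n x y"
proof -
  obtain f where f: "\<And>v x y. Q (f v) x y \<Longrightarrow> x v = y v" using ev by metis
  have "agree n x y" if "Q (Max ((\<lambda>i. f (from_nat i)) ` {..<n})) x y" for x y
    unfolding agree_def
  proof (intro allI impI)
    fix i assume "i < n"
    then have "f (from_nat i) \<le> Max ((\<lambda>i. f (from_nat i)) ` {..<n})" by simp
    then show "x (from_nat i) = y (from_nat i)" using f mono that by blast
  qed
  then show ?thesis by blast
qed

lemma neq_imp_first_difference:
  assumes "x \<noteq> y"
  obtains n where "agree n x y" "x (from_nat n) \<noteq> y (from_nat n)"
proof -
  define n where "n = (LEAST n. x (from_nat n) \<noteq> y (from_nat n))"
  obtain v where "x v \<noteq> y v" using assms by blast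
  then have "x (from_nat (to_nat v)) \<noteq> y (from_nat (to_nat v))" by simp
  then have "\<exists>n. x (from_nat n) \<noteq> y (from_nat n)" by blast
  then have "x (from_nat n) \<noteq> y (from_nat n)"
    unfolding n_def by (rule LeastI_ex)
  moreover have "agree n x y"
    unfolding agree_def n_def using not_less_Least by blast
  ultimately show ?thesis using that by blast
qed

lemma dist_less_if_agree:
  assumes "0 < e"
  shows "\<exists>n. \<forall>x y :: 'i::countable \<Rightarrow> bool. agree n x y \<longrightarrow> dist x y < e"
proof -
  obtain N where N: "(1/2::real) ^ N < e"
    using real_arch_pow_inv[OF assms, of "1/2"] by auto
  have "dist x y < e" if "agree (Suc N) x y" for x y :: "'i \<Rightarrow> bool"
  proof -
    have "{dist (x (from_nat n)) (y (from_nat n)) |n. n \<le> N} = {0}"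
      using that by (auto simp: agree_def less_Suc_eq_le intro!: exI[of _ N])
    then show ?thesis
      using dist_fun_le_dist_first_terms[of x y N] N by simp
  qed
  then show ?thesis by blast
qed

lemma agree_if_dist_less:
  "\<exists>e>0. \<forall>x y :: 'i::countable \<Rightarrow> bool. dist x y < e \<longrightarrow> agree n x y"
proof (intro exI conjI allI impI)
  fix x y :: "'i \<Rightarrow> bool" assume d: "dist x y < (1/2) ^ n"
  let ?f = "\<lambda>m. (1/2) ^ m * min (dist (x (from_nat m)) (y (from_nat m))) (1::real)"
  have "summable (\<lambda>n. (1 / 2 :: real) ^ n)" by (simp add: summable_geometric_iff)
  then have s: "summable ?f" by (rule summable_comparison_test'[where N = 0]) simp
  show "agree n x y"
    unfolding agree_def
  proof (intro allI impI, rule ccontr)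
    fix i assume i: "i < n" "x (from_nat i) \<noteq> y (from_nat i)"
    have "(1/2::real) ^ n \<le> (1/2) ^ i"
      using i by (intro power_decreasing) auto
    also have "\<dots> = ?f i" using i by (simp add: dist_bool_def)
    also have "\<dots> \<le> dist x y"
      unfolding dist_fun_def using sum_le_suminf[OF s, of "{i}"] by simp
    finally show False using d by simp
  qed
qed simp

lemma compact_bool_fun: "compact (UNIV :: ('i::countable \<Rightarrow> bool) set)"
proof -
  have "compact_space (euclidean :: bool topology)"
    by (simp add: compact_space_def finite_imp_compactin del: compactin_euclidean_iff)
  then have "compact_space (product_topology (\<lambda>_::'i. euclidean :: bool topology) UNIV)"
    by (simp add: compact_space_product_topology)
  then show ?thesis
    by (simp add: euclidean_product_topology compact_space_def)
qed

lemma closure_agree_iff: "x \<in> closure A \<longleftrightarrow> (\<forall>n. \<exists>a\<in>A. agree n x a)"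
proof
  assume *: "x \<in> closure A"
  show "\<forall>n. \<exists>a\<in>A. agree n x a"
  proof
    fix n
    obtain e where "e > 0" "\<forall>x y :: 'a \<Rightarrow> bool. dist x y < e \<longrightarrow> agree n x y"
      using agree_if_dist_less by blast
    then show "\<exists>a\<in>A. agree n x a"
      using * unfolding closure_approachable by (metis agree_sym)
  qed
next
  assume *: "\<forall>n. \<exists>a\<in>A. agree n x a"
  show "x \<in> closure A"
    unfolding closure_approachable
  proof (intro allI impI)
    fix e :: real assume "e > 0"
    then obtain n where "\<forall>x y :: 'a \<Rightarrow> bool. agree n x y \<longrightarrow> dist x y < e"
      using dist_less_if_agree by blast
    then show "\<exists>y\<in>A. dist y x < e"
      using * by (metis agree_sym)
  qed
qed

lemma closed_agree:
  assumes "\<And>x y :: 'i::countable \<Rightarrow> bool. agree n x y \<Longrightarrow> Q x = Q y"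
  shows "closed {x. Q x}"
proof -
  have "closure {x. Q x} \<subseteq> {x. Q x}"
  proof
    fix x assume "x \<in> closure {x. Q x}"
    then obtain a where "Q a" "agree n x a"
      unfolding closure_agree_iff by blast
    then show "x \<in> {x. Q x}" using assms by blast
  qed
  then show ?thesis by (simp add: closure_subset_eq)
qed

lemma continuous_on_agreeI:
  fixes F :: "('i::countable \<Rightarrow> bool) \<Rightarrow> ('j::countable \<Rightarrow> bool)"
  assumes "\<And>x n. x \<in> P \<Longrightarrow> \<exists>m. \<forall>y\<in>P. agree m x y \<longrightarrow> agree n (F x) (F y)"
  shows "continuous_on P F"
  unfolding continuous_on_iff
proof (intro ballI allI impI)
  fix x and e :: real assume x: "x \<in> P" and "0 < e"
  then obtain n where n: "\<forall>x y :: 'j \<Rightarrow> bool. agree n x y \<longrightarrow> dist x y < e"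
    using dist_less_if_agree by blast
  obtain m where m: "\<forall>y\<in>P. agree m x y \<longrightarrow> agree n (F x) (F y)" using assms x by blast
  obtain d where d: "d > 0" "\<forall>x y :: 'i \<Rightarrow> bool. dist x y < d \<longrightarrow> agree m x y"
    using agree_if_dist_less by blast
  have "dist (F x') (F x) < e" if "x' \<in> P" "dist x' x < d" for x'
  proof -
    have "agree m x x'" using d(2) that(2) agree_sym by blast
    then have "agree n (F x') (F x)" using m that(1) agree_sym by blast
    then show ?thesis using n by blast
  qed
  then show "\<exists>d>0. \<forall>x'\<in>P. dist x' x < d \<longrightarrow> dist (F x') (F x) < e"
    using d(1) by blast
qed

lemma compact_continuous_agree:
  fixes F :: "('i::countable \<Rightarrow> bool) \<Rightarrow> ('j::countable \<Rightarrow> bool)"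
  assumes "compact P" "continuous_on P F"
  shows "\<exists>m. \<forall>x\<in>P. \<forall>y\<in>P. agree m x y \<longrightarrow> agree n (F x) (F y)"
proof -
  have "uniformly_continuous_on P F"
    using assms compact_uniformly_continuous by blast
  moreover obtain e where e: "e > 0" "\<forall>x y :: 'j \<Rightarrow> bool. dist x y < e \<longrightarrow> agree n x y"
    using agree_if_dist_less by blast
  ultimately obtain d where d: "d > 0" "\<forall>x\<in>P. \<forall>x'\<in>P. dist x' x < d \<longrightarrow> dist (F x') (F x) < e"
    unfolding uniformly_continuous_on_def by metis
  obtain m where "\<forall>x y :: 'i \<Rightarrow> bool. agree m x y \<longrightarrow> dist x y < d"
    using dist_less_if_agree[OF d(1)] by blast
  then show ?thesis using d e by (metis agree_sym)
qed

section \<open>Coding perfect closed sets by the Cantor set\<close>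

definition branching :: "('i::countable \<Rightarrow> bool) set \<Rightarrow> nat \<Rightarrow> ('i \<Rightarrow> bool) \<Rightarrow> bool"
  where "branching P n x \<longleftrightarrow>
    (\<exists>y\<in>P. \<exists>z\<in>P. agree n x y \<and> agree n x z \<and> y (from_nat n) \<noteq> z (from_nat n))"

definition branch_count :: "('i::countable \<Rightarrow> bool) set \<Rightarrow> nat \<Rightarrow> ('i \<Rightarrow> bool) \<Rightarrow> nat"
  where "branch_count P n x = card {i. i < n \<and> branching P i x}"

text \<open>Positions where \<open>P\<close> leaves no choice are skipped and the remaining bits are
  renumbered consecutively, which identifies a perfect closed set with the full binary tree.\<close>

definition code :: "('i::countable \<Rightarrow> bool) set \<Rightarrow> ('i \<Rightarrow> bool) \<Rightarrow> cantor"
  where "code P x m \<longleftrightarrow> (\<exists>i. branching P i x \<and> branch_count P i x = m \<and> x (from_nat i))"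

lemma branching_cong: "agree n x y \<Longrightarrow> branching P n x = branching P n y"
  unfolding branching_def by (metis agree_sym agree_trans)

lemma branch_count_cong:
  assumes "agree n x y"
  shows "branch_count P n x = branch_count P n y"
proof -
  have "branching P i x = branching P i y" if "i < n" for i
    using branching_cong agree_mono[OF assms] that by (metis less_imp_le)
  then show ?thesis unfolding branch_count_def by (metis (lifting))
qed

lemma branch_count_0 [simp]: "branch_count P 0 x = 0"
  by (simp add: branch_count_def)

lemma branch_count_Suc:
  "branch_count P (Suc n) x = branch_count P n x + of_bool (branching P n x)"
proof -
  have "{i. i < Suc n \<and> branching P i x} =
      (if branching P n x then insert n else id) {i. i < n \<and> branching P i x}"
    by (auto simp: less_Suc_eq)
  then show ?thesis unfolding branch_count_def by simp
qed

lemma branch_count_mono: "m \<le> n \<Longrightarrow> branch_count P m x \<le> branch_count P n x"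
  unfolding branch_count_def by (intro card_mono) auto

lemma branch_count_inject:
  assumes "branching P i x" "branching P j x" "branch_count P i x = branch_count P j x"
  shows "i = j"
proof -
  have "branch_count P i x < branch_count P j x" if "i < j" "branching P i x" for i j
    using branch_count_mono[of "Suc i" j P x] that by (simp add: branch_count_Suc)
  then show ?thesis using assms by (metis less_irrefl nat_neq_iff)
qed

lemma code_branch_count:
  "branching P i x \<Longrightarrow> code P x (branch_count P i x) = x (from_nat i)"
  unfolding code_def using branch_count_inject by metis

locale cantor_subset =
  fixes P :: "('i::countable \<Rightarrow> bool) set"
  assumes closed: "closed P"
    and nonempty: "P \<noteq> {}"
    and perfect: "x \<in> P \<Longrightarrow> \<exists>y\<in>P. agree n x y \<and> y \<noteq> x"
begin

lemma compact: "compact P"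
  using closed compact_bool_fun by (metis compact_Int_closed inf_top_left)

text \<open>A second point of \<open>P\<close> agreeing with \<open>x\<close> up to \<open>n\<close>
  first leaves \<open>x\<close> at a branching position not below \<open>n\<close>; the least such
  position has no uncounted branching before it.\<close>

lemma ex_next_branching:
  assumes "x \<in> P"
  shows "\<exists>i\<ge>n. branching P i x \<and> branch_count P i x = branch_count P n x"
proof -
  obtain y where y: "y \<in> P" "agree n x y" "x \<noteq> y" using perfect[OF assms] by metis
  obtain i where i: "agree i x y" "x (from_nat i) \<noteq> y (from_nat i)"
    using neq_imp_first_difference[OF y(3)] by blast
  have b: "branching P i x \<and> n \<le> i"
    unfolding branching_def
    using i y assms by (metis agree_def agree_refl not_less)
  define k where "k = (LEAST i. branching P i x \<and> n \<le> i)"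
  have k: "branching P k x" "n \<le> k"
    using LeastI[of "\<lambda>i. branching P i x \<and> n \<le> i", OF b] unfolding k_def by auto
  have "\<not> (branching P l x \<and> n \<le> l)" if "l < k" for l
    using that not_less_Least unfolding k_def by blast
  then have "{i. i < k \<and> branching P i x} = {i. i < n \<and> branching P i x}"
    using k(2) by (auto simp: not_le) 
  then show ?thesis using k unfolding branch_count_def by auto
qed

lemma ex_branching:
  assumes "x \<in> P"
  shows "\<exists>i. branching P i x \<and> branch_count P i x = m"
proof -
  have "\<exists>n. branch_count P n x = m"
  proof (induction m)
    case 0
    show ?case by (meson branch_count_0)
  next
    case (Suc m)
    then obtain n where "branch_count P n x = m" by blast
    then obtain i where "branching P i x" "branch_count P i x = m"
      using ex_next_branching[OF assms] by blast
    then show ?case by (intro exI[of _ "Suc i"]) (simp add: branch_count_Suc)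
  qed
  then show ?thesis using ex_next_branching[OF assms] by blast
qed

lemma code_cong:
  assumes "x \<in> P"
  shows "\<exists>n. \<forall>y. agree n x y \<longrightarrow> code P x m = code P y m"
proof -
  obtain i where i: "branching P i x" "branch_count P i x = m"
    using ex_branching[OF assms] by blast
  have "code P x m = code P y m" if "agree (Suc i) x y" for y
  proof -
    have "branching P i y" "branch_count P i y = m" "x (from_nat i) = y (from_nat i)"
      using that i branching_cong branch_count_cong by (metis agree_Suc)+
    then show ?thesis using i code_branch_count by metis
  qed
  then show ?thesis by blast
qed

lemma continuous_on_code: "continuous_on P (code P)"
proof (rule continuous_on_agreeI)
  fix x n assume x: "x \<in> P"
  obtain f where f: "\<And>m y. agree (f m) x y \<Longrightarrow> code P x m = code P y m"
    using code_cong[OF x] by metis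
  have "agree n (code P x) (code P y)" if "agree (Max ((\<lambda>i. f (from_nat i)) ` {..<n})) x y" for y
    unfolding agree_def[of n]
  proof (intro allI impI)
    fix i assume "i < n"
    then have "f (from_nat i) \<le> Max ((\<lambda>i. f (from_nat i)) ` {..<n})" by simp
    then show "code P x (from_nat i) = code P y (from_nat i)"
      using f agree_mono that by blast
  qed
  then show "\<exists>m. \<forall>y\<in>P. agree m x y \<longrightarrow> agree n (code P x) (code P y)" by blast
qed

lemma inj_on_code: "inj_on (code P) P"
proof (rule inj_onI, rule ccontr)
  fix x y assume xy: "x \<in> P" "y \<in> P" "code P x = code P y" "x \<noteq> y"
  obtain i where i: "agree i x y" "x (from_nat i) \<noteq> y (from_nat i)"
    using neq_imp_first_difference[OF xy(4)] by blast
  have "branching P i x" unfolding branching_def using i xy agree_refl by blast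
  moreover have "branching P i y" using branching_cong i(1) calculation by blast
  moreover have "branch_count P i x = branch_count P i y" using branch_count_cong i(1) by blast
  ultimately show False using code_branch_count xy(3) i(2) by metis
qed

text \<open>At the next branching position some point of \<open>P\<close> has the wanted bit, and
  passing to it keeps the earlier code bits, which are read at strictly smaller positions.\<close>

lemma ex_code_prefix: "\<exists>x\<in>P. \<forall>i<m. code P x i = b i"
proof (induction m)
  case 0
  show ?case using nonempty by blast
next
  case (Suc m)
  then obtain x where x: "x \<in> P" "\<forall>i<m. code P x i = b i" by blast
  obtain i where i: "branching P i x" "branch_count P i x = m"
    using ex_branching[OF x(1)] by blast
  then obtain y where y: "y \<in> P" "agree i x y" "y (from_nat i) = b m"
    unfolding branching_def by metis
  have "code P y k = b k" if "k < Suc m" for k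
  proof (cases "k = m")
    case True
    then show ?thesis
      using y i branching_cong branch_count_cong code_branch_count by metis
  next
    case False
    then have "k < m" using that by simp
    obtain l where l: "branching P l x" "branch_count P l x = k"
      using ex_branching[OF x(1)] by blast
    have "l < i"
      using branch_count_mono[of i l P x] \<open>k < m\<close> i l by (meson leD not_le_imp_less)
    then have "agree (Suc l) x y" using y(2) agree_mono by (metis Suc_leI)
    then have "branching P l y" "branch_count P l y = k" "x (from_nat l) = y (from_nat l)"
      using l branching_cong branch_count_cong by (metis agree_Suc)+
    then show ?thesis using l code_branch_count x(2) \<open>k < m\<close> by metis
  qed
  then show ?case using y(1) by blast
qed

lemma code_image: "code P ` P = UNIV"
proof -
  have "b \<in> closure (code P ` P)" for b
    unfolding closure_agree_iff
  proof
    fix n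
    obtain x where x: "x \<in> P" "\<forall>i < Suc (Max (from_nat ` {..<n} :: nat set)). code P x i = b i"
      using ex_code_prefix by blast
    have "(from_nat i :: nat) < Suc (Max (from_nat ` {..<n} :: nat set))" if "i < n" for i
      using that by (simp add: less_Suc_eq_le)
    then have "agree n b (code P x)"
      unfolding agree_def using x(2) by metis
    then show "\<exists>a\<in>code P ` P. agree n b a" using x(1) by blast
  qed
  moreover have "closed (code P ` P)"
    by (intro compact_imp_closed compact_continuous_image continuous_on_code compact)
  ultimately show ?thesis by (metis UNIV_eq_I closure_closed)
qed

lemma homeomorphism_code: "homeomorphism P UNIV (code P) (inv_into P (code P))"
proof -
  have "\<exists>g. homeomorphism P UNIV (code P) g"
    by (rule homeomorphism_compact) (use compact continuous_on_code code_image inj_on_code in auto)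
  then obtain g where g: "homeomorphism P UNIV (code P) g" by blast
  moreover have "g = inv_into P (code P)"
  proof
    fix b
    have "g b \<in> P" "code P (g b) = b" using g by (auto simp: homeomorphism_def)
    then show "g b = inv_into P (code P) b" by (metis inj_on_code inv_into_f_f)
  qed
  ultimately show ?thesis by simp
qed

text \<open>The points whose first \<open>N\<close> branchings do not all occur below
  \<open>M\<close> form closed sets decreasing in \<open>M\<close>. If \<open>P\<close> met all of
  them, compactness would give a point with too few branchings.\<close>

lemma uniform_branching:
  "\<exists>M. \<forall>x\<in>P. \<forall>m<N. \<exists>i<M. branching P i x \<and> branch_count P i x = m"
proof (rule ccontr)
  define Q where "Q M x \<longleftrightarrow> (\<forall>m<N. \<exists>i<M. branching P i x \<and> branch_count P i x = m)" for M x
  assume "\<not> ?thesis"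
  then have ne: "P \<inter> {x. \<not> Q M x} \<noteq> {}" for M unfolding Q_def by blast
  have cl: "closed {x. \<not> Q M x}" for M
  proof (rule closed_agree[of M])
    fix x y :: "'i \<Rightarrow> bool" assume "agree M x y"
    then have "branching P i x = branching P i y" "branch_count P i x = branch_count P i y" if "i < M" for i
      using branching_cong branch_count_cong agree_mono that by (metis less_imp_le)+
    then show "(\<not> Q M x) = (\<not> Q M y)" unfolding Q_def by metis
  qed
  have fip: "P \<inter> (\<Inter>M\<in>I. {x. \<not> Q M x}) \<noteq> {}" if "finite I" for I
  proof -
    have "{x. \<not> Q (Max I) x} \<subseteq> {x. \<not> Q M x}" if "M \<in> I" for M
    proof -
      have "M \<le> Max I" using that \<open>finite I\<close> by simp
      then show ?thesis unfolding Q_def by (auto intro: less_le_trans)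
    qed
    then show ?thesis using ne[of "Max I"] by blast
  qed
  have "P \<inter> (\<Inter>M\<in>UNIV. {x. \<not> Q M x}) \<noteq> {}"
    using compact_imp_fip_image[where f = "\<lambda>M. {x. \<not> Q M x}" and I = UNIV, OF compact cl fip] .
  then obtain x where x: "x \<in> P" "\<And>M. \<not> Q M x" by auto
  obtain f where f: "\<And>m. branching P (f m) x \<and> branch_count P (f m) x = m"
    using ex_branching[OF x(1)] by metis
  have "f m < Suc (Max (f ` {..<N}))" if "m < N" for m
    using that by (simp add: less_Suc_eq_le)
  then have "Q (Suc (Max (f ` {..<N}))) x"
    unfolding Q_def using f by blast
  then show False using x(2) by blast
qed

end

section \<open>Transport of maps to the Cantor set and its continuity\<close>

definition coded_map :: "('i::countable \<Rightarrow> bool) set \<Rightarrow> (('i \<Rightarrow> bool) \<Rightarrow> 'i \<Rightarrow> bool) \<Rightarrow> cantor \<Rightarrow> cantor"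
  where "coded_map P S = code P \<circ> S \<circ> inv_into P (code P)"

text \<open>Closeness of closed sets in the Vietoris topology.\<close>

definition same_prefixes :: "nat \<Rightarrow> ('i::countable \<Rightarrow> bool) set \<Rightarrow> ('i \<Rightarrow> bool) set \<Rightarrow> bool"
  where "same_prefixes n P Q \<longleftrightarrow> (\<forall>x. (\<exists>y\<in>P. agree n x y) \<longleftrightarrow> (\<exists>y\<in>Q. agree n x y))"

lemma same_prefixes_mono:
  assumes "same_prefixes n P Q" "m \<le> n"
  shows "same_prefixes m P Q"
  using assms unfolding same_prefixes_def
  by (meson agree_mono agree_refl agree_trans)

lemma same_prefixes_branching:
  assumes "same_prefixes n P Q" "i < n"
  shows "branching P i x = branching Q i x"
proof -
  have "branching B i x" if AB: "same_prefixes n A B" and A: "branching A i x"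
    for A B :: "('a \<Rightarrow> bool) set"
  proof -
    have *: "\<exists>y'\<in>B. agree i x y' \<and> y' (from_nat i) = y (from_nat i)" if "y \<in> A" "agree i x y" for y
    proof -
      obtain y' where y': "y' \<in> B" "agree n y y'"
        using AB \<open>y \<in> A\<close> unfolding same_prefixes_def by (meson agree_refl)
      then have "agree (Suc i) y y'" using assms(2) by (intro agree_mono[OF y'(2)]) simp
      then show ?thesis using that(2) agree_trans y'(1) by (metis agree_Suc)
    qed
    obtain y z where "y \<in> A" "z \<in> A" "agree i x y" "agree i x z" "y (from_nat i) \<noteq> z (from_nat i)"
      using A unfolding branching_def by blast
    with *[of y] *[of z] show ?thesis unfolding branching_def by metis
  qed
  moreover have "same_prefixes n Q P" using assms(1) unfolding same_prefixes_def by simp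
  ultimately show ?thesis using assms(1) by blast
qed

lemma same_prefixes_branch_count:
  assumes "same_prefixes n P Q" "i \<le> n"
  shows "branch_count P i x = branch_count Q i x"
proof -
  have "branching P k x = branching Q k x" if "k < i" for k
    using same_prefixes_branching[OF assms(1)] assms(2) that by simp
  then show ?thesis unfolding branch_count_def by (metis (lifting))
qed

text \<open>Decoding a point of the Cantor set, moving it and coding the result only reads a bounded
  part of the set of prefixes; this makes \<^const>\<open>coded_map\<close> continuous in the closed set.\<close>

lemma coded_map_agree:
  fixes P :: "('i::countable \<Rightarrow> bool) set"
  assumes P: "cantor_subset P" and SP: "S ` P \<subseteq> P"
    and S: "\<And>n. \<exists>m. \<forall>x y. agree m x y \<longrightarrow> agree n (S x) (S y)"
  shows "\<exists>M. \<forall>Q. cantor_subset Q \<longrightarrow> S ` Q \<subseteq> Q \<longrightarrow> same_prefixes M P Q \<longrightarrow>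
    (\<forall>b. agree N (coded_map P S b) (coded_map Q S b))"
proof -
  interpret P: cantor_subset P by fact
  \<comment> \<open>Code bits are themselves enumerated through \<open>from_nat\<close>, so
    agreement up to \<open>N\<close> involves code bits below some \<open>L\<close> that may exceed
    \<open>N\<close>.\<close>
  obtain L where L: "\<And>i. i < N \<Longrightarrow> (from_nat i :: nat) < L"
    using finite_nat_set_iff_bounded[of "from_nat ` {..<N}"] by auto
  obtain M0 where M0: "\<forall>x\<in>P. \<forall>m<L. \<exists>i<M0. branching P i x \<and> branch_count P i x = m"
    using P.uniform_branching by blast
  obtain M1 where M1: "\<forall>x y. agree M1 x y \<longrightarrow> agree M0 (S x) (S y)" using S by blast
  show ?thesis
  proof (rule exI[of _ "max M0 M1"], intro allI impI)
    fix Q b assume "cantor_subset Q" and SQ: "S ` Q \<subseteq> Q" and PQ: "same_prefixes (max M0 M1) P Q"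
    interpret Q: cantor_subset Q by fact
    define x where "x = inv_into P (code P) b"
    define y where "y = inv_into Q (code Q) b"
    have x: "x \<in> P" "code P x = b"
      unfolding x_def using P.homeomorphism_code by (auto simp: homeomorphism_def)
    have y: "y \<in> Q" "code Q y = b"
      unfolding y_def using Q.homeomorphism_code by (auto simp: homeomorphism_def)
    \<comment> \<open>If the two decoded points first differed below \<open>M1\<close>, both would
      branch there with the same count, and one bit of their common code \<open>b\<close> would have
      two values.\<close>
    have "agree M1 x y"
    proof (rule ccontr)
      assume na: "\<not> agree M1 x y"
      then have "x \<noteq> y" by auto
      then obtain i where i: "agree i x y" "x (from_nat i) \<noteq> y (from_nat i)"
        by (rule neq_imp_first_difference)
      have "i < M1"
        using i na agree_mono by (metis not_le_imp_less)
      have PQi: "same_prefixes (Suc i) P Q"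
        using PQ same_prefixes_mono \<open>i < M1\<close> by (metis Suc_leI max.coboundedI2)
      obtain y' where y': "y' \<in> P" "agree (Suc i) y y'"
        using PQi y(1) unfolding same_prefixes_def by (meson agree_refl)
      have bx: "branching P i x"
        unfolding branching_def
      proof (intro bexI conjI)
        show "agree i x y'" "x (from_nat i) \<noteq> y' (from_nat i)"
          using y' i agree_trans by (auto simp: agree_Suc)
      qed (use x y' in auto)
      have by': "branching Q i y"
        using bx same_prefixes_branching[OF PQi] branching_cong[OF i(1)] by simp
      have "branch_count P i x = branch_count Q i y"
        using same_prefixes_branch_count[OF PQi] branch_count_cong[OF i(1)] by simp
      then show False
        using code_branch_count[OF bx] code_branch_count[OF by'] x y i(2) by simp
    qed
    then have ag: "agree M0 (S x) (S y)" using M1 by blast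
    have "code P (S x) m = code Q (S y) m" if m: "m < L" for m
    proof -
      have "S x \<in> P" using SP x by blast
      then obtain i where i: "i < M0" "branching P i (S x)" "branch_count P i (S x) = m"
        using M0 m by blast
      have PQi: "same_prefixes (Suc i) P Q"
        using PQ same_prefixes_mono i(1) by (metis Suc_leI max.coboundedI1)
      have agi: "agree (Suc i) (S x) (S y)" using ag i(1) agree_mono by (metis Suc_leI)
      then have "branching Q i (S y)" "branch_count Q i (S y) = m"
        using i same_prefixes_branching[OF PQi] same_prefixes_branch_count[OF PQi]
          branching_cong branch_count_cong by (metis agree_Suc lessI le_SucI order_refl)+
      then show ?thesis
        using i code_branch_count agi by (metis agree_Suc)
    qed
    then show "agree N (coded_map P S b) (coded_map Q S b)"
      unfolding agree_def coded_map_def using L by (simp add: x_def y_def)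
  qed
qed

lemma coded_map_Homeo:
  assumes "cantor_subset P" "homeomorphism P P S S'"
  shows "coded_map P S \<in> Homeo" "inv (coded_map P S) = coded_map P S'"
proof -
  have "homeomorphism UNIV P (inv_into P (code P)) (code P)"
    using cantor_subset.homeomorphism_code[OF assms(1)] by (rule homeomorphism_symD)
  from homeomorphism_compose[OF this homeomorphism_compose[OF assms(2) cantor_subset.homeomorphism_code[OF assms(1)]]]
  have *: "homeomorphism UNIV UNIV (coded_map P S) (coded_map P S')"
    unfolding coded_map_def by (simp add: comp_assoc)
  then show "coded_map P S \<in> Homeo" unfolding Homeo_def by blast
  show "inv (coded_map P S) = coded_map P S'"
    using * by (intro inv_unique_comp) (auto simp: homeomorphism_def fun_eq_iff)
qed

lemma coded_map_Min_Homeo: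
  assumes P: "cantor_subset P" and S: "homeomorphism P P S S'"
    and dense: "\<And>x. x \<in> P \<Longrightarrow> P \<subseteq> closure {(S ^^ n) x | n. True}"
  shows "coded_map P S \<in> Min_Homeo"
proof -
  interpret cantor_subset P by fact
  let ?g = "inv_into P (code P)"
  have g: "?g b \<in> P" "code P (?g b) = b" for b
    using homeomorphism_code by (auto simp: homeomorphism_def)
  have SP: "S x \<in> P" if "x \<in> P" for x using S that by (auto simp: homeomorphism_def)
  have pow: "(coded_map P S ^^ n) b = code P ((S ^^ n) (?g b)) \<and> (S ^^ n) (?g b) \<in> P" for n b
    by (induction n) (auto simp: g coded_map_def SP inv_into_f_f inj_on_code)
  have "closure (orbit (coded_map P S) b) = UNIV" for b
  proof -
    let ?O = "{(S ^^ n) (?g b) | n. True}"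
    have "code P ` P \<subseteq> code P ` closure ?O" using dense[OF g(1)] by blast
    also have "\<dots> \<subseteq> closure (code P ` ?O)"
    proof (rule image_closure_subset)
      have "?O \<subseteq> P" using pow by blast
      then have "closure ?O \<subseteq> P" using closed by (simp add: closure_minimal)
      then show "continuous_on (closure ?O) (code P)"
        using continuous_on_code continuous_on_subset by blast
      show "code P ` ?O \<subseteq> closure (code P ` ?O)" by (rule closure_subset)
    qed simp
    also have "\<dots> \<subseteq> closure (orbit (coded_map P S) b)"
    proof (rule closure_mono, safe)
      fix n
      have "int_iterate (coded_map P S) (int n) b = code P ((S ^^ n) (?g b))"
        using pow by (simp add: int_iterate_def)
      then show "code P ((S ^^ n) (?g b)) \<in> orbit (coded_map P S) b"
        unfolding orbit_def by (metis (mono_tags, lifting) mem_Collect_eq)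
    qed
    finally show ?thesis by (simp add: code_image top.extremum_unique)
  qed
  then show ?thesis
    unfolding Min_Homeo_def using coded_map_Homeo[OF P S] by simp
qed

section \<open>Lacunary elements of odometers\<close>

text \<open>For a fixed prime these powers determine its adic integers. Repeated squaring makes a
  modulus eventually exceed any fixed multiple of the sum of its predecessors.\<close>

definition modulus :: "nat \<Rightarrow> nat \<Rightarrow> int"
  where "modulus j r = int (enumerate {p. prime p} j) ^ (2 ^ r)"

lemma prime_enumerate: "prime (enumerate {p::nat. prime p} j)"
  using enumerate_in_set[OF primes_infinite, of j] by simp

lemma modulus_Suc: "modulus j (Suc r) = modulus j r * modulus j r"
  by (simp add: modulus_def mult_2 flip: power_add)

lemma modulus_gt: "int r + 1 < modulus j r"
proof (induction r)
  case 0
  show ?case using prime_ge_2_nat[OF prime_enumerate, of j] by (simp add: modulus_def)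
next
  case (Suc r)
  have "2 * (int r + 2) \<le> modulus j r * modulus j r"
    using Suc by (intro mult_mono) auto
  then show ?case by (simp add: modulus_Suc)
qed

lemma modulus_pos [simp]: "0 < modulus j r" "modulus j r \<noteq> 0"
  using modulus_gt[of r j] by auto

lemma modulus_dvd_modulus: "r \<le> s \<Longrightarrow> modulus j r dvd modulus j s"
  unfolding modulus_def by (intro le_imp_power_dvd) simp

lemma not_modulus_Suc_dvd: "\<not> modulus j (Suc r) dvd modulus j r"
proof
  assume "modulus j (Suc r) dvd modulus j r"
  then have "modulus j (Suc r) \<le> modulus j r" by (simp add: zdvd_imp_le)
  then show False using modulus_gt[of r j] by (simp add: modulus_Suc)
qed

lemma coprime_modulus: "i \<noteq> j \<Longrightarrow> coprime (modulus i r) (modulus j s)"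
proof -
  assume "i \<noteq> j"
  then have "enumerate {p::nat. prime p} i \<noteq> enumerate {p. prime p} j"
    using strict_mono_enumerate[OF primes_infinite] strict_mono_eq by blast
  then have "coprime (enumerate {p::nat. prime p} i) (enumerate {p. prime p} j)"
    by (intro primes_coprime_nat prime_enumerate)
  then show ?thesis unfolding modulus_def by simp
qed

lemma all_modulus_dvd_0: "(\<And>r. modulus j r dvd c) \<Longrightarrow> c = 0"
proof (rule ccontr)
  assume d: "\<And>r. modulus j r dvd c" and "c \<noteq> 0"
  then have "modulus j (nat \<bar>c\<bar>) \<le> \<bar>c\<bar>" using zdvd_imp_le[of _ "\<bar>c\<bar>"] by simp
  then show False using modulus_gt[of "nat \<bar>c\<bar>" j] by simp
qed

lemma chinese_remainder_modulus: "\<exists>k. \<forall>j\<le>m. modulus j R dvd k - \<delta> j"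
proof (induction m)
  case 0
  show ?case by (rule exI[of _ "\<delta> 0"]) simp
next
  case (Suc m)
  then obtain k where k: "\<And>j. j \<le> m \<Longrightarrow> modulus j R dvd k - \<delta> j" by blast
  have "coprime (\<Prod>j\<le>m. modulus j R) (modulus (Suc m) R)"
    by (intro prod_coprime_left coprime_modulus) auto
  then obtain x where x: "[x = k] (mod (\<Prod>j\<le>m. modulus j R))" "[x = \<delta> (Suc m)] (mod modulus (Suc m) R)"
    using binary_chinese_remainder_int by blast
  have "modulus j R dvd x - \<delta> j" if "j \<le> Suc m" for j
  proof (cases "j = Suc m")
    case True
    then show ?thesis using x(2) by (simp add: cong_iff_dvd_diff)
  next
    case False
    then have j: "j \<le> m" using that by simp
    have "modulus j R dvd (\<Prod>j\<le>m. modulus j R)" using j by (intro dvd_prodI) auto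
    then have "modulus j R dvd x - k" using x(1) dvd_trans by (auto simp: cong_iff_dvd_diff)
    then have "modulus j R dvd (x - k) + (k - \<delta> j)" using k[OF j] by (rule dvd_add)
    then show ?thesis by simp
  qed
  then show ?case by blast
qed

lemma ex_common_multiple: "\<exists>M>0. \<forall>j\<le>R. \<forall>r\<le>R. modulus j r dvd M"
proof (intro exI conjI allI impI)
  show "0 < (\<Prod>j\<le>R. modulus j R)" by (intro prod_pos) simp
  fix j r assume "j \<le> R" "r \<le> R"
  then have "modulus j R dvd (\<Prod>j\<le>R. modulus j R)" by (intro dvd_prodI) auto
  then show "modulus j r dvd (\<Prod>j\<le>R. modulus j R)"
    using modulus_dvd_modulus[OF \<open>r \<le> R\<close>] dvd_trans by blast
qed

text \<open>These are the points of the product of the odometers; \<open>\<delta> j r\<close> is a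
  representative that matters only modulo \<open>modulus j r\<close>.\<close>

definition coherent :: "(nat \<Rightarrow> nat \<Rightarrow> int) \<Rightarrow> bool"
  where "coherent \<delta> \<longleftrightarrow> (\<forall>j r. modulus j r dvd \<delta> j (Suc r) - \<delta> j r)"

lemma coherentD:
  assumes "coherent \<delta>" "r \<le> s"
  shows "modulus j r dvd \<delta> j s - \<delta> j r"
  using assms(2)
proof (induction s rule: dec_induct)
  case (step s)
  have "modulus j r dvd \<delta> j (Suc s) - \<delta> j s"
    using assms(1) step(1) modulus_dvd_modulus dvd_trans unfolding coherent_def
    by (metis less_imp_le)
  then have "modulus j r dvd (\<delta> j (Suc s) - \<delta> j s) + (\<delta> j s - \<delta> j r)"
    using step(3) by (rule dvd_add)
  then show ?case by simp
qed simp

text \<open>The integers are dense in the product of the odometers, by the Chinese remainder theorem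
  at the highest level needed.\<close>

lemma coherent_approx:
  assumes "coherent \<delta>"
  shows "\<exists>k. \<forall>j\<le>R. \<forall>r\<le>R. modulus j r dvd k - \<delta> j r"
proof -
  obtain k where k: "\<forall>j\<le>R. modulus j R dvd k - \<delta> j R"
    using chinese_remainder_modulus[of R R "\<lambda>j. \<delta> j R"] by blast
  have "modulus j r dvd k - \<delta> j r" if "j \<le> R" "r \<le> R" for j r
  proof -
    have "modulus j r dvd (k - \<delta> j R) + (\<delta> j R - \<delta> j r)"
      using k that modulus_dvd_modulus dvd_trans coherentD[OF assms that(2)]
      by (metis dvd_add)
    then show ?thesis by simp
  qed
  then show ?thesis by blast
qed

text \<open>The second component of the pair is a dummy: it lets every word label infinitely many
  indices.\<close>

definition label :: "nat \<Rightarrow> nat list"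
  where "label t = fst (from_nat t :: nat list \<times> nat)"

lemma ex_label: "\<exists>t\<ge>t0. label t = w"
proof -
  have "inj (\<lambda>i::nat. to_nat (w, i))" by (intro injI) simp
  then have "infinite (range (\<lambda>i::nat. to_nat (w, i)))" using range_inj_infinite by blast
  then obtain t where "t \<ge> t0" "t \<in> range (\<lambda>i::nat. to_nat (w, i))"
    by (meson infinite_nat_iff_unbounded_le)
  then show ?thesis unfolding label_def by (intro exI[of _ t]) auto
qed

text \<open>Partial sums of a combination of independent series, one for each word \<open>u\<close>,
  consisting of the moduli at the indices labelled \<open>u\<close>.\<close>

definition lacunary :: "nat \<Rightarrow> (nat list \<Rightarrow> int) \<Rightarrow> nat \<Rightarrow> int"
  where "lacunary j f r = (\<Sum>t<r. f (label t) * modulus j t)"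

lemma lacunary_Suc: "lacunary j f (Suc r) = lacunary j f r + f (label r) * modulus j r"
  by (simp add: lacunary_def)

lemma lacunary_add: "lacunary j (\<lambda>u. f u + g u) r = lacunary j f r + lacunary j g r"
  by (simp add: lacunary_def algebra_simps sum.distrib)

lemma lacunary_diff: "lacunary j (\<lambda>u. f u - g u) r = lacunary j f r - lacunary j g r"
  by (simp add: lacunary_def algebra_simps sum_subtractf)

lemma lacunary_mult: "lacunary j (\<lambda>u. c * f u) r = c * lacunary j f r"
  by (simp add: lacunary_def algebra_simps sum_distrib_left)

lemma lacunary_0 [simp]: "lacunary j (\<lambda>u. 0) r = 0"
  by (simp add: lacunary_def)

lemma coherent_lacunary: "coherent (\<lambda>j. lacunary j (f j))"
  unfolding coherent_def by (simp add: lacunary_Suc)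

lemma sum_modulus_le: "(\<Sum>t<r. modulus j t) \<le> modulus j r"
proof (induction r)
  case 0
  show ?case using less_imp_le[OF modulus_pos(1)] by simp
next
  case (Suc r)
  have "2 * modulus j r \<le> modulus j r * modulus j r"
    using modulus_gt[of r j] by (intro mult_right_mono) auto
  moreover have "(\<Sum>t<Suc r. modulus j t) \<le> 2 * modulus j r" using Suc by simp
  ultimately show ?case unfolding modulus_Suc by linarith
qed

text \<open>A partial sum of bounded multiples of the rapidly growing moduli is eventually smaller than
  the next modulus, so it vanishes as soon as it is divisible by it.\<close>

lemma lacunary_independent:
  assumes dvd: "\<And>r. modulus j r dvd lacunary j f r + c" and B: "\<And>u. \<bar>f u\<bar> \<le> B"
  shows "f u = 0" "c = 0"
proof -
  have B0: "0 \<le> B" using B[of "[]"] by linarith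
  have zero: "lacunary j f (Suc r) + c = 0" if "nat (\<bar>c\<bar> + 2 * B) \<le> r" for r
  proof -
    have "\<bar>lacunary j f (Suc r)\<bar> \<le> (\<Sum>t<Suc r. B * modulus j t)"
      unfolding lacunary_def
      by (rule order_trans[OF sum_abs sum_mono]) (simp add: abs_mult B mult_right_mono less_imp_le)
    also have "\<dots> \<le> 2 * B * modulus j r"
      using mult_left_mono[OF sum_modulus_le[of j r] B0] by (simp add: algebra_simps sum_distrib_left)
    finally have "\<bar>lacunary j f (Suc r) + c\<bar> \<le> 2 * B * modulus j r + \<bar>c\<bar> * 1"
      by linarith
    also have "\<dots> \<le> 2 * B * modulus j r + \<bar>c\<bar> * modulus j r"
      using modulus_gt[of r j] by (intro add_left_mono mult_left_mono) auto
    also have "\<dots> = (\<bar>c\<bar> + 2 * B) * modulus j r" by (simp add: algebra_simps)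
    also have "\<dots> < modulus j r * modulus j r"
      using modulus_gt[of r j] that by (intro mult_strict_right_mono) auto
    finally have "\<bar>lacunary j f (Suc r) + c\<bar> < modulus j (Suc r)" by (simp add: modulus_Suc)
    then show ?thesis
      using dvd[of "Suc r"] zdvd_imp_le[of "modulus j (Suc r)" "\<bar>lacunary j f (Suc r) + c\<bar>"]
      by (metis abs_eq_0 abs_ge_zero dvd_abs_iff linorder_not_less order_le_less)
  qed
  have f0: "f u = 0" for u
  proof -
    \<comment> \<open>Past the bound consecutive partial sums both equal \<open>- c\<close>, so the
      term between them, here one labelled \<open>u\<close>, vanishes.\<close>
    obtain t where t: "t \<ge> Suc (nat (\<bar>c\<bar> + 2 * B))" "label t = u" using ex_label by blast
    then obtain s where s: "t = Suc s" "nat (\<bar>c\<bar> + 2 * B) \<le> s" by (cases t) auto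
    have "lacunary j f (Suc t) = lacunary j f t"
      using zero[OF s(2)] zero[of t] s by simp
    then show ?thesis using t(2) by (simp add: lacunary_Suc)
  qed
  then show "f u = 0" .
  have "f = (\<lambda>u. 0)" using f0 by blast
  then show "c = 0" using dvd all_modulus_dvd_0[of j c] by simp
qed

section \<open>Toeplitz arrays\<close>

text \<open>The row \<open>Inl (j, r, i)\<close> records residues; the row \<open>Inr (n, ws, vs)\<close> splits
  every point of the odometer whose coordinates up to \<open>n\<close> are those of the point \<open>centre n ws vs\<close>.
  Coordinate \<open>0\<close> of the centre only remembers \<open>n\<close>. Its coordinate \<open>j\<close> is the combination
  \<open>\<Sum>w\<in>ws. u (take j w) - \<Sum>v\<in>vs. u (take j v)\<close> of the independent elements
  \<open>u w = \<Sum>{p\<^sub>j\<^bsup>2^t\<^esup> | t. label t = w}\<close>.\<close>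

type_synonym row = "(nat \<times> nat \<times> int) + (nat \<times> nat list list \<times> nat list list)"

type_synonym point = "int \<times> row \<Rightarrow> bool"

definition coef :: "nat \<Rightarrow> nat list list \<Rightarrow> nat list list \<Rightarrow> nat \<Rightarrow> nat list \<Rightarrow> int"
  where "coef n ws vs j u =
    (if j = 0 then of_bool (u = replicate n 0)
     else int (count_list (map (take j) ws) u) - int (count_list (map (take j) vs) u))"

definition centre :: "nat \<Rightarrow> nat list list \<Rightarrow> nat list list \<Rightarrow> nat \<Rightarrow> nat \<Rightarrow> int"
  where "centre n ws vs j = lacunary j (coef n ws vs j)"

text \<open>The parity of the level at which \<open>k\<close> separates from
  \<open>\<delta>\<close>: locally constant off the coset of \<open>\<delta>\<close> given by the
  coordinates up to \<open>n\<close>, but taking both values arbitrarily close to it. This is what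
  splits points.\<close>

definition depth_parity :: "nat \<Rightarrow> (nat \<Rightarrow> nat \<Rightarrow> int) \<Rightarrow> int \<Rightarrow> bool"
  where "depth_parity n \<delta> k = even (LEAST r. \<exists>j\<le>n. \<not> modulus j r dvd k - \<delta> j r)"

text \<open>The length condition makes \<open>c\<close> the coefficient sum of the combination of
  words.\<close>

definition admissible ::
    "(nat list \<Rightarrow> bool) \<Rightarrow> nat \<Rightarrow> nat \<Rightarrow> nat list list \<Rightarrow> nat list list \<Rightarrow> bool"
  where "admissible T c n ws vs \<longleftrightarrow>
    (\<forall>w\<in>set ws \<union> set vs. T w \<and> length w = n) \<and> length ws = length vs + c"

text \<open>Inadmissible rows are kept and filled with \<open>False\<close>, so the index set does
  not vary with the tree and each row consults \<open>T\<close> at finitely many words only.\<close>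

definition base_point :: "(nat list \<Rightarrow> bool) \<Rightarrow> nat \<Rightarrow> point"
  where "base_point T c = (\<lambda>(k, v). case v of
      Inl (j, r, i) \<Rightarrow> modulus j r dvd k - i
    | Inr (n, ws, vs) \<Rightarrow> admissible T c n ws vs \<and> depth_parity n (centre n ws vs) k)"

definition shift :: "int \<Rightarrow> point \<Rightarrow> point"
  where "shift k x = (\<lambda>(l, v). x (l + k, v))"

definition system :: "(nat list \<Rightarrow> bool) \<Rightarrow> nat \<Rightarrow> point set"
  where "system T c = closure (range (\<lambda>k. shift k (base_point T c)))"

lemma base_point_Inl [simp]: "base_point T c (k, Inl (j, r, i)) \<longleftrightarrow> modulus j r dvd k - i"
  by (simp add: base_point_def)

lemma base_point_Inr [simp]: "base_point T c (k, Inr (n, ws, vs)) \<longleftrightarrow>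
    admissible T c n ws vs \<and> depth_parity n (centre n ws vs) k"
  by (simp add: base_point_def)

lemma shift_apply [simp]: "shift k x (l, v) = x (l + k, v)"
  by (simp add: shift_def)

lemma shift_shift [simp]: "shift k (shift l x) = shift (k + l) x"
  by (auto simp: shift_def fun_eq_iff algebra_simps)

lemma shift_0 [simp]: "shift 0 x = x"
  by (auto simp: shift_def)

lemma shift_1_funpow: "(shift 1 ^^ n) x = shift (int n) x"
  by (induction n) (auto simp: algebra_simps)

lemma abs_coef_le: "\<bar>coef n ws vs j u\<bar> \<le> 1 + int (length ws) + int (length vs)"
proof -
  have "count_list (map (take j) ws) u \<le> length ws" "count_list (map (take j) vs) u \<le> length vs"
    using count_le_length[of "map (take j) ws" u] count_le_length[of "map (take j) vs" u] by auto
  then show ?thesis unfolding coef_def by auto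
qed

lemma coherent_centre: "coherent (centre n ws vs)"
  unfolding centre_def by (rule coherent_lacunary)

section \<open>Local constancy, recurrence and minimality\<close>

lemma dvd_iff_if_dvd_diff: "m dvd b - a \<Longrightarrow> m dvd b \<longleftrightarrow> m dvd (a::int)"
  using dvd_add_right_iff[of m "b - a" a] by simp

text \<open>A failure at level \<open>r\<close> bounds the least failing level by \<open>r\<close>,
  so congruences up to level \<open>r\<close> preserve that level.\<close>

lemma depth_parity_cong:
  assumes "j \<le> n" "\<not> modulus j r dvd k - \<delta> j r"
    and eq: "\<And>i s. i \<le> n \<Longrightarrow> s \<le> r \<Longrightarrow> modulus i s dvd (k' - \<delta>' i s) - (k - \<delta> i s)"
  shows "depth_parity n \<delta> k = depth_parity n \<delta>' k'"
proof -
  let ?P = "\<lambda>\<delta> k r. \<exists>j\<le>n. \<not> modulus j r dvd k - \<delta> j r"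
  have PP: "?P \<delta> k s \<longleftrightarrow> ?P \<delta>' k' s" if "s \<le> r" for s
    using dvd_iff_if_dvd_diff[OF eq] that by auto
  define s where "s = (LEAST s. ?P \<delta> k s)"
  have s: "?P \<delta> k s" "s \<le> r"
    unfolding s_def using assms(1,2) by (rule_tac LeastI[of "?P \<delta> k" r] Least_le; blast)+
  have "(LEAST s. ?P \<delta>' k' s) = s"
  proof (rule Least_equality)
    show "?P \<delta>' k' s" using PP s by blast
    show "s \<le> s'" if "?P \<delta>' k' s'" for s'
    proof (rule ccontr)
      assume "\<not> s \<le> s'"
      then have "?P \<delta> k s'" "s' < s" using that PP[of s'] s(2) by auto
      then show False using not_less_Least unfolding s_def by blast
    qed
  qed
  then show ?thesis unfolding depth_parity_def s_def by simp
qed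

text \<open>Coordinate \<open>0\<close> of a centre is a nontrivial lacunary series, which
  independence separates from every integer. Hence the minimum in \<open>depth_parity\<close> exists
  at all integers.\<close>

lemma centre_not_integer: "\<exists>r. \<not> modulus 0 r dvd k - centre n ws vs 0 r"
proof (rule ccontr)
  assume "\<not> ?thesis"
  then have d: "modulus 0 r dvd k - centre n ws vs 0 r" for r by blast
  have "modulus 0 r dvd lacunary 0 (coef n ws vs 0) r + (- k)" for r
    using d[of r] by (simp add: centre_def dvd_diff_commute)
  from lacunary_independent(1)[OF this abs_coef_le, of "replicate n 0"]
  show False by (simp add: coef_def)
qed

text \<open>The Toeplitz property: each entry recurs along an arithmetic progression, since the
  level deciding it is finite.\<close>

lemma base_point_recurrent_at:
  "\<exists>R. \<forall>k. (\<forall>j\<le>R. \<forall>r\<le>R. modulus j r dvd k) \<longrightarrow> base_point T c (l + k, v) = base_point T c (l, v)"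
proof (cases v)
  case (Inl a)
  obtain j r i where [simp]: "a = (j, r, i)" by (cases a)
  have "base_point T c (l + k, v) = base_point T c (l, v)"
    if "\<forall>j'\<le>max j r. \<forall>r'\<le>max j r. modulus j' r' dvd k" for k
  proof -
    have "modulus j r dvd k" using that by simp
    then have "modulus j r dvd k + (l - i) \<longleftrightarrow> modulus j r dvd l - i" by (rule dvd_add_right_iff)
    then show ?thesis by (simp add: Inl algebra_simps)
  qed
  then show ?thesis by blast
next
  case (Inr a)
  obtain n ws vs where [simp]: "a = (n, ws, vs)" by (cases a)
  obtain r where r: "\<not> modulus 0 r dvd l - centre n ws vs 0 r" using centre_not_integer by blast
  have "base_point T c (l + k, v) = base_point T c (l, v)"
    if "\<forall>j'\<le>max n r. \<forall>r'\<le>max n r. modulus j' r' dvd k" for k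
  proof -
    have "depth_parity n (centre n ws vs) l = depth_parity n (centre n ws vs) (l + k)"
      by (rule depth_parity_cong[of 0 n r l "centre n ws vs"]) (use that r in auto)
    then show ?thesis by (simp add: Inr)
  qed
  then show ?thesis by blast
qed

lemma base_point_recurrent:
  "\<exists>R. \<forall>k. (\<forall>j\<le>R. \<forall>r\<le>R. modulus j r dvd k) \<longrightarrow>
     agree n (shift l (base_point T c)) (shift (l + k) (base_point T c))"
proof -
  let ?b = "base_point T c"
  have "\<exists>R. \<forall>x y. (\<exists>k. (\<forall>j\<le>R. \<forall>r\<le>R. modulus j r dvd k) \<and> x = shift l ?b \<and> y = shift (l + k) ?b)
      \<longrightarrow> agree n x y"
  proof (rule agree_uniform)
    fix v :: "int \<times> row"
    obtain a u where v: "v = (a, u)" by fastforce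
    obtain R where "\<forall>k. (\<forall>j\<le>R. \<forall>r\<le>R. modulus j r dvd k) \<longrightarrow> ?b (a + l + k, u) = ?b (a + l, u)"
      using base_point_recurrent_at[where l = "a + l" and v = u] by blast
    then show "\<exists>R. \<forall>x y. (\<exists>k. (\<forall>j\<le>R. \<forall>r\<le>R. modulus j r dvd k) \<and> x = shift l ?b \<and> y = shift (l + k) ?b)
        \<longrightarrow> x v = y v"
      by (intro exI[of _ R] allI impI, elim exE conjE)
         (simp only: v shift_apply add.assoc[symmetric])
  next
    fix R R' :: nat and x y assume "R \<le> R'"
      "\<exists>k. (\<forall>j\<le>R'. \<forall>r\<le>R'. modulus j r dvd k) \<and> x = shift l ?b \<and> y = shift (l + k) ?b"
    moreover from this obtain k where "x = shift l ?b" "y = shift (l + k) ?b"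
      "\<forall>j\<le>R'. \<forall>r\<le>R'. modulus j r dvd k" by blast
    ultimately show "\<exists>k. (\<forall>j\<le>R. \<forall>r\<le>R. modulus j r dvd k) \<and> x = shift l ?b \<and> y = shift (l + k) ?b"
      by (intro exI[of _ k]) simp
  qed
  then obtain R where R: "\<forall>x y. (\<exists>k. (\<forall>j\<le>R. \<forall>r\<le>R. modulus j r dvd k) \<and> x = shift l ?b \<and>
      y = shift (l + k) ?b) \<longrightarrow> agree n x y" ..
  have "agree n (shift l ?b) (shift (l + k) ?b)" if "\<forall>j\<le>R. \<forall>r\<le>R. modulus j r dvd k" for k
    by (rule R[rule_format]) (use that in blast)
  then show ?thesis by blast
qed

lemma agree_shift:
  assumes "finite A"
  shows "\<exists>m. \<forall>x y. agree m x y \<longrightarrow> (\<forall>l\<in>A. agree n (shift l x) (shift l y))"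
proof -
  let ?W = "(\<lambda>(l, i). (fst (from_nat i :: int \<times> row) + l, snd (from_nat i :: int \<times> row))) ` (A \<times> {..<n})"
  have "finite ?W" using assms by simp
  from agree_finite[OF this] obtain m where
    m: "\<forall>x y. agree m x y \<longrightarrow> (\<forall>v\<in>?W. x v = y v)" by blast
  have "agree n (shift l x) (shift l y)" if "agree m x y" "l \<in> A" for x y l
    unfolding agree_def
  proof (intro allI impI)
    fix i assume "i < n"
    then have "(fst (from_nat i :: int \<times> row) + l, snd (from_nat i :: int \<times> row)) \<in> ?W"
      using that(2) by force
    then have "x (fst (from_nat i :: int \<times> row) + l, snd (from_nat i :: int \<times> row)) =
        y (fst (from_nat i :: int \<times> row) + l, snd (from_nat i :: int \<times> row))"
      using m that(1) by blast
    then show "shift l x (from_nat i) = shift l y (from_nat i)"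
      by (simp add: shift_def split_beta)
  qed
  then show ?thesis by blast
qed

lemma mem_system_iff: "x \<in> system T c \<longleftrightarrow> (\<forall>n. \<exists>k. agree n x (shift k (base_point T c)))"
  unfolding system_def closure_agree_iff by blast

lemma shift_base_point_in_system: "shift k (base_point T c) \<in> system T c"
  unfolding mem_system_iff using agree_refl by blast

lemma shift_in_system:
  assumes "x \<in> system T c"
  shows "shift l x \<in> system T c"
  unfolding mem_system_iff
proof
  fix n
  obtain m where "\<forall>x y. agree m x y \<longrightarrow> agree n (shift l x) (shift l y)"
    using agree_shift[of "{l}" n] by auto
  then show "\<exists>k. agree n (shift l x) (shift k (base_point T c))"
    using assms unfolding mem_system_iff by (metis shift_shift)
qed

lemma continuous_on_shift: "continuous_on A (shift l)"
proof (rule continuous_on_agreeI)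
  fix x n
  show "\<exists>m. \<forall>y\<in>A. agree m x y \<longrightarrow> agree n (shift l x) (shift l y)"
    using agree_shift[of "{l}" n] by auto
qed

lemma homeomorphism_shift: "homeomorphism (system T c) (system T c) (shift l) (shift (- l))"
proof -
  have "x \<in> shift l ` system T c" if "x \<in> system T c" for x l
    by (rule image_eqI[of _ _ "shift (- l) x"]) (use that shift_in_system in auto)
  then have "shift l ` system T c = system T c" for l
    using shift_in_system by blast
  then show ?thesis
    unfolding homeomorphism_def using continuous_on_shift by simp
qed

lemma system_dense_orbit:
  assumes "x \<in> system T c"
  shows "system T c \<subseteq> closure {(shift 1 ^^ n) x | n. True}"
proof
  fix y assume y: "y \<in> system T c"
  show "y \<in> closure {(shift 1 ^^ n) x | n. True}"
    unfolding closure_agree_iff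
  proof
    fix n
    obtain k where k: "agree n y (shift k (base_point T c))" using y mem_system_iff by blast
    obtain R where R: "\<And>l. (\<forall>j\<le>R. \<forall>r\<le>R. modulus j r dvd l) \<Longrightarrow>
        agree n (shift k (base_point T c)) (shift (k + l) (base_point T c))"
      using base_point_recurrent[where l = k and n = n and T = T and c = c] by blast
    obtain M where "M > 0" and M: "\<And>j r. j \<le> R \<Longrightarrow> r \<le> R \<Longrightarrow> modulus j r dvd M"
      using ex_common_multiple[of R] by blast
    obtain m where m: "\<forall>x y. agree m x y \<longrightarrow> (\<forall>l\<in>{0..<M}. agree n (shift l x) (shift l y))"
      using agree_shift[of "{0..<M}" n] by auto
    obtain h where h: "agree m x (shift h (base_point T c))"
      using assms mem_system_iff by blast
    \<comment> \<open>The window \<open>m\<close> was chosen for all shifts in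
      \<open>{0..<M}\<close> before \<open>h\<close> was known. Reducing modulo \<open>M\<close>
      brings the needed shift into that range and changes \<open>k\<close> only by a period.\<close>
    define l where "l = (k - h) mod M"
    have l: "0 \<le> l" "l < M" unfolding l_def using \<open>M > 0\<close> by auto
    have "l + h = k + M * (- ((k - h) div M))"
      unfolding l_def using mult_div_mod_eq[of M "k - h"] by (simp add: algebra_simps)
    then have "agree n (shift k (base_point T c)) (shift (l + h) (base_point T c))"
      using R M by (metis dvd_mult2)
    moreover have "agree n (shift l x) (shift (l + h) (base_point T c))"
      using m h l by fastforce
    ultimately have "agree n y (shift l x)"
      using k by (meson agree_sym agree_trans)
    moreover have "shift l x \<in> {(shift 1 ^^ n) x | n. True}"
      using l shift_1_funpow[of "nat l" x] by (intro CollectI exI[of _ "nat l"]) simp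
    ultimately show "\<exists>a\<in>{(shift 1 ^^ n) x | n. True}. agree n y a" by blast
  qed
qed

lemma cantor_subset_system: "cantor_subset (system T c)"
proof
  show "closed (system T c)" unfolding system_def by simp
  show "system T c \<noteq> {}" using shift_base_point_in_system by blast
  fix x n assume "x \<in> system T c"
  then obtain k where k: "agree n x (shift k (base_point T c))" using mem_system_iff by blast
  obtain R where R: "\<And>l. (\<forall>j\<le>R. \<forall>r\<le>R. modulus j r dvd l) \<Longrightarrow>
      agree n (shift k (base_point T c)) (shift (k + l) (base_point T c))"
    using base_point_recurrent[where l = k and n = n and T = T and c = c] by blast
  obtain M where "M > 0" and M: "\<And>j r. j \<le> R \<Longrightarrow> r \<le> R \<Longrightarrow> modulus j r dvd M"
    using ex_common_multiple[of R] by blast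
  \<comment> \<open>The nonzero period \<open>M\<close> is not divisible by every modulus, so a
    residue row tells the two shifts apart although both agree with \<open>x\<close> up to
    \<open>n\<close>; at least one of them is not \<open>x\<close>.\<close>
  then obtain r where r: "\<not> modulus 0 r dvd M" using all_modulus_dvd_0[of 0 M] by auto
  have "shift k (base_point T c) (0, Inl (0, r, k)) \<noteq> shift (k + M) (base_point T c) (0, Inl (0, r, k))"
    using r by simp
  then have "shift k (base_point T c) \<noteq> shift (k + M) (base_point T c)" by metis
  moreover have "agree n x (shift (k + M) (base_point T c))"
    using M by (intro agree_trans[OF k R]) blast
  ultimately show "\<exists>y\<in>system T c. agree n x y \<and> y \<noteq> x"
    using k shift_base_point_in_system[of _ T c] by (cases "shift k (base_point T c) = x") auto
qed

section \<open>Dependence of the systems on the tree\<close>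

lemma base_point_local:
  "\<exists>D. finite D \<and> (\<forall>T'. (\<forall>w\<in>D. T' w = T w) \<longrightarrow>
     (\<forall>k. agree n (shift k (base_point T c)) (shift k (base_point T' c))))"
proof -
  define words :: "row \<Rightarrow> nat list set"
    where "words v = (case v of Inl _ \<Rightarrow> {} | Inr (n, ws, vs) \<Rightarrow> set ws \<union> set vs)" for v
  have fin: "finite (words v)" for v by (auto simp: words_def split: sum.split)
  have eq: "base_point T c (k, v) = base_point T' c (k, v)" if "\<forall>w\<in>words v. T' w = T w" for T' k v
    using that unfolding words_def base_point_def admissible_def
    by (auto split: sum.splits)
  let ?D = "\<Union>i<n. words (snd (from_nat i :: int \<times> row))"
  have "agree n (shift k (base_point T c)) (shift k (base_point T' c))" if "\<forall>w\<in>?D. T' w = T w" for T' k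
    unfolding agree_def shift_def using that by (auto simp: split_beta intro!: eq)
  then show ?thesis using fin by (intro exI[of _ ?D]) auto
qed

lemma same_prefixes_system:
  "\<exists>D. finite D \<and> (\<forall>T'. (\<forall>w\<in>D. T' w = T w) \<longrightarrow> same_prefixes n (system T c) (system T' c))"
proof -
  obtain D where D: "finite D" "\<forall>T'. (\<forall>w\<in>D. T' w = T w) \<longrightarrow>
     (\<forall>k. agree n (shift k (base_point T c)) (shift k (base_point T' c)))"
    using base_point_local by blast
  have *: "(\<exists>y\<in>system T c. agree n x y) \<longleftrightarrow> (\<exists>k. agree n x (shift k (base_point T c)))" for x T
  proof
    assume "\<exists>y\<in>system T c. agree n x y"
    then obtain y where "y \<in> system T c" "agree n x y" by blast
    moreover obtain k where "agree n y (shift k (base_point T c))"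
      using \<open>y \<in> system T c\<close> mem_system_iff by blast
    ultimately have "agree n x (shift k (base_point T c))" using agree_trans by blast
    then show "\<exists>k. agree n x (shift k (base_point T c))" by blast
  next
    assume "\<exists>k. agree n x (shift k (base_point T c))"
    then show "\<exists>y\<in>system T c. agree n x y" using shift_base_point_in_system by blast
  qed
  have "same_prefixes n (system T c) (system T' c)" if "\<forall>w\<in>D. T' w = T w" for T'
  proof -
    have "agree n (shift k (base_point T c)) (shift k (base_point T' c))" for k
      using D(2) that by blast
    then show ?thesis
      unfolding same_prefixes_def * by (meson agree_sym agree_trans)
  qed
  then show ?thesis using D(1) by blast
qed

section \<open>Rigidity\<close>

text \<open>The residue rows give the projection to the odometers: if shifts by \<open>k\<close>
  approximate \<open>y\<close>, then \<open>k\<close> converges to \<open>z\<close>. Enlarging the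
  window to contain these rows achieves both approximations with one \<open>k\<close>.\<close>

lemma odometer_coordinates:
  assumes "y \<in> system T c"
  shows "\<exists>z. coherent z \<and> (\<forall>R n. \<exists>k. agree n y (shift k (base_point T c)) \<and>
    (\<forall>j\<le>R. \<forall>r\<le>R. modulus j r dvd k - z j r))"
proof -
  let ?b = "base_point T c"
  have "\<exists>i. y (0, Inl (j, r, i))" for j r
  proof -
    have "finite ((\<lambda>i. (0 :: int, Inl (j, r, i) :: row)) ` {0..<modulus j r})" by simp
    from agree_finite[OF this] obtain m where m: "\<forall>x y :: point. agree m x y \<longrightarrow>
        (\<forall>v\<in>(\<lambda>i. (0, Inl (j, r, i))) ` {0..<modulus j r}. x v = y v)" by blast
    obtain k where k: "agree m y (shift k ?b)" using assms mem_system_iff by blast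
    have "(0, Inl (j, r, k mod modulus j r)) \<in> (\<lambda>i. (0, Inl (j, r, i))) ` {0..<modulus j r}"
      by simp
    then have "y (0, Inl (j, r, k mod modulus j r)) = shift k ?b (0, Inl (j, r, k mod modulus j r))"
      by (rule m[rule_format, OF k])
    then show ?thesis by auto
  qed
  then obtain z where z: "\<And>j r. y (0, Inl (j, r, z j r))" by metis
  have approx: "\<exists>k. agree n y (shift k ?b) \<and> (\<forall>j\<le>R. \<forall>r\<le>R. modulus j r dvd k - z j r)" for R n
  proof -
    let ?W = "(\<lambda>(j, r). (0 :: int, Inl (j, r, z j r) :: row)) ` ({..R} \<times> {..R})"
    have "finite ?W" by simp
    from agree_finite[OF this] obtain m where m: "\<forall>x y :: point. agree m x y \<longrightarrow> (\<forall>v\<in>?W. x v = y v)"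
      by blast
    obtain k where k: "agree (max m n) y (shift k ?b)" using assms mem_system_iff by blast
    have "modulus j r dvd k - z j r" if "j \<le> R" "r \<le> R" for j r
    proof -
      have "(0, Inl (j, r, z j r)) \<in> ?W" using that by force
      then have "y (0, Inl (j, r, z j r)) = shift k ?b (0, Inl (j, r, z j r))"
        by (rule m[rule_format, OF agree_mono[OF k max.cobounded1]])
      then show ?thesis using z by simp
    qed
    then show ?thesis using agree_mono[OF k, of n] by auto
  qed
  have "modulus j r dvd z j (Suc r) - z j r" for j r
  proof -
    obtain k where k: "\<forall>j'\<le>max j (Suc r). \<forall>r'\<le>max j (Suc r). modulus j' r' dvd k - z j' r'"
      using approx by blast
    have "modulus j r dvd modulus j (Suc r)" by (simp add: modulus_dvd_modulus)
    moreover have "modulus j (Suc r) dvd k - z j (Suc r)" using k by simp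
    ultimately have "modulus j r dvd k - z j (Suc r)" by (rule dvd_trans)
    moreover have "modulus j r dvd k - z j r" using k by simp
    ultimately have "modulus j r dvd (k - z j r) - (k - z j (Suc r))" by (simp only: dvd_diff)
    then show ?thesis by (simp add: algebra_simps)
  qed
  then show ?thesis using approx unfolding coherent_def by blast
qed

lemma depth_parity_oscillates:
  assumes "coherent \<delta>"
  shows "\<exists>k s. depth_parity n \<delta> k = b \<and> \<not> modulus 0 s dvd k - \<delta> 0 s \<and>
    (\<forall>j\<le>R. \<forall>r\<le>R. modulus j r dvd k - \<delta> j r)"
proof -
  obtain s where s: "even (Suc s) = b" "R \<le> s"
    by (cases "even (Suc R) = b") (auto intro: that[of R] that[of "Suc R"])
  \<comment> \<open>Adding \<open>modulus 0 s\<close> in coordinate \<open>0\<close> is invisible up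
    to level \<open>s\<close> and visible at level \<open>Suc s\<close>, whose parity was
    prescribed.\<close>
  obtain k where k: "\<And>j. j \<le> max n R \<Longrightarrow>
      modulus j (Suc s) dvd k - (\<delta> j (Suc s) + (if j = 0 then modulus 0 s else 0))"
    using chinese_remainder_modulus[of "max n R" "Suc s"
        "\<lambda>j. \<delta> j (Suc s) + (if j = 0 then modulus 0 s else 0)"] by blast
  have good: "modulus j r dvd k - \<delta> j r" if "j \<le> max n R" "r \<le> s" for j r
  proof -
    have "modulus j r dvd k - (\<delta> j (Suc s) + (if j = 0 then modulus 0 s else 0))"
      using k[OF that(1)] that(2) modulus_dvd_modulus dvd_trans by (metis le_SucI)
    moreover have "modulus j r dvd (if j = 0 then modulus 0 s else 0)"
      using that(2) modulus_dvd_modulus by auto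
    moreover have "modulus j r dvd \<delta> j (Suc s) - \<delta> j r"
      using coherentD[OF assms] that(2) by simp
    ultimately have "modulus j r dvd (k - (\<delta> j (Suc s) + (if j = 0 then modulus 0 s else 0)))
        + ((if j = 0 then modulus 0 s else 0) + (\<delta> j (Suc s) - \<delta> j r))"
      by (intro dvd_add)
    then show ?thesis by (simp add: algebra_simps)
  qed
  have bad: "\<not> modulus 0 (Suc s) dvd k - \<delta> 0 (Suc s)"
  proof
    assume "modulus 0 (Suc s) dvd k - \<delta> 0 (Suc s)"
    moreover have "modulus 0 (Suc s) dvd k - (\<delta> 0 (Suc s) + modulus 0 s)" using k[of 0] by simp
    ultimately have "modulus 0 (Suc s) dvd (k - \<delta> 0 (Suc s)) - (k - (\<delta> 0 (Suc s) + modulus 0 s))"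
      by (rule dvd_diff)
    then show False using not_modulus_Suc_dvd by simp
  qed
  have "(LEAST r. \<exists>j\<le>n. \<not> modulus j r dvd k - \<delta> j r) = Suc s"
  proof (rule Least_equality)
    show "\<exists>j\<le>n. \<not> modulus j (Suc s) dvd k - \<delta> j (Suc s)" using bad by blast
    fix r assume "\<exists>j\<le>n. \<not> modulus j r dvd k - \<delta> j r"
    then show "Suc s \<le> r" using good by (meson le_max_iff_disj not_less_eq_eq)
  qed
  then have "depth_parity n \<delta> k = b" unfolding depth_parity_def using s by simp
  then show ?thesis using bad good s(2) by (intro exI[of _ k] exI[of _ "Suc s"]) auto
qed

text \<open>Here integers approach a point \<open>d\<close> of the odometers. As long as
  \<open>d + l\<close> lies off the split coset of the row, a finite level witnesses this and fixes
  the entry near \<open>d\<close>.\<close>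

lemma base_point_constant_near:
  assumes "\<And>n' ws' vs'. v = Inr (n', ws', vs') \<Longrightarrow> admissible T c n' ws' vs' \<Longrightarrow>
      \<exists>j\<le>n'. \<exists>r. \<not> modulus j r dvd d j r + l - centre n' ws' vs' j r"
  shows "\<exists>R. \<forall>k k'. (\<forall>j\<le>R. \<forall>r\<le>R. modulus j r dvd k - d j r \<and> modulus j r dvd k' - d j r) \<longrightarrow>
    base_point T c (l + k, v) = base_point T c (l + k', v)"
proof (cases v)
  case (Inl a)
  obtain j r i where a: "a = (j, r, i)" by (cases a)
  have "base_point T c (l + k, v) = base_point T c (l + k', v)"
    if "\<forall>j'\<le>max j r. \<forall>r'\<le>max j r. modulus j' r' dvd k - d j' r' \<and> modulus j' r' dvd k' - d j' r'" for k k'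
  proof -
    have "modulus j r dvd (k - d j r) - (k' - d j r)" by (rule dvd_diff) (use that in simp_all)
    then have "modulus j r dvd (l + k - i) - (l + k' - i)" by (simp add: algebra_simps)
    from dvd_iff_if_dvd_diff[OF this] show ?thesis by (simp add: Inl a)
  qed
  then show ?thesis by blast
next
  case (Inr a)
  obtain n ws vs where a: "a = (n, ws, vs)" by (cases a)
  show ?thesis
  proof (cases "admissible T c n ws vs")
    case False
    then show ?thesis by (simp add: Inr a)
  next
    case True
    then obtain j r where jr: "j \<le> n" "\<not> modulus j r dvd d j r + l - centre n ws vs j r"
      using assms Inr a by blast
    have "base_point T c (l + k, v) = base_point T c (l + k', v)"
      if H: "\<forall>j\<le>max n r. \<forall>r'\<le>max n r. modulus j r' dvd k - d j r' \<and> modulus j r' dvd k' - d j r'" for k k'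
    proof -
      have "depth_parity n (centre n ws vs) (l + k) = depth_parity n (centre n ws vs) (l + k')"
      proof (rule depth_parity_cong[OF jr(1)])
        have "modulus j r dvd k - d j r" using H jr(1) by simp
        then have "modulus j r dvd (l + k - centre n ws vs j r) - (d j r + l - centre n ws vs j r)"
          by (simp add: algebra_simps)
        from dvd_iff_if_dvd_diff[OF this] show "\<not> modulus j r dvd l + k - centre n ws vs j r"
          using jr(2) by simp
      next
        fix i s assume ins: "i \<le> n" "s \<le> r"
        have "modulus i s dvd (k' - d i s) - (k - d i s)"
          by (rule dvd_diff) (use H ins in simp_all)
        then show "modulus i s dvd (l + k' - centre n ws vs i s) - (l + k - centre n ws vs i s)"
          by (simp add: algebra_simps)
      qed
      then show ?thesis by (simp add: Inr a)
    qed
    then show ?thesis by blast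
  qed
qed

lemma base_point_agree_near:
  assumes near: "\<And>l n' ws' vs'. admissible T c n' ws' vs' \<Longrightarrow>
      \<exists>j\<le>n'. \<exists>r. \<not> modulus j r dvd d j r + l - centre n' ws' vs' j r"
  shows "\<exists>R. \<forall>k k'. (\<forall>j\<le>R. \<forall>r\<le>R. modulus j r dvd k - d j r \<and> modulus j r dvd k' - d j r) \<longrightarrow>
    agree m (shift k (base_point T c)) (shift k' (base_point T c))"
proof -
  let ?b = "base_point T c"
  let ?near = "\<lambda>R k k'. \<forall>j\<le>R. \<forall>r\<le>R. modulus j r dvd k - d j r \<and> modulus j r dvd k' - d j r"
  have "\<exists>R. \<forall>x y. (\<exists>k k'. ?near R k k' \<and> x = shift k ?b \<and> y = shift k' ?b) \<longrightarrow> agree m x y"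
  proof (rule agree_uniform)
    fix v :: "int \<times> row"
    obtain l u where v: "v = (l, u)" by fastforce
    obtain R where "\<forall>k k'. ?near R k k' \<longrightarrow> ?b (l + k, u) = ?b (l + k', u)"
      using base_point_constant_near[of u T c d l] near by blast
    then show "\<exists>R. \<forall>x y. (\<exists>k k'. ?near R k k' \<and> x = shift k ?b \<and> y = shift k' ?b) \<longrightarrow> x v = y v"
      by (intro exI[of _ R] allI impI, elim exE conjE) (simp only: v shift_apply)
  next
    fix R R' :: nat and x y assume "R \<le> R'"
      "\<exists>k k'. ?near R' k k' \<and> x = shift k ?b \<and> y = shift k' ?b"
    moreover from this obtain k k' where "x = shift k ?b" "y = shift k' ?b" "?near R' k k'"
      by blast
    ultimately show "\<exists>k k'. ?near R k k' \<and> x = shift k ?b \<and> y = shift k' ?b"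
      by (intro exI[of _ k] exI[of _ k']) simp
  qed
  then obtain R where R: "\<forall>x y. (\<exists>k k'. ?near R k k' \<and> x = shift k ?b \<and> y = shift k' ?b) \<longrightarrow> agree m x y" ..
  have "agree m (shift k ?b) (shift k' ?b)" if "?near R k k'" for k k'
    by (rule R[rule_format]) (use that in blast)
  then show ?thesis by blast
qed

text \<open>The sign \<open>\<epsilon>\<close> treats conjugacies with the shift and with its
  inverse together.\<close>

locale equivariant_map =
  fixes T T' :: "nat list \<Rightarrow> bool" and c c' :: nat and F :: "point \<Rightarrow> point" and \<epsilon> :: int
  assumes continuous: "continuous_on (system T c) F"
    and maps_to: "F ` system T c \<subseteq> system T' c'"
    and sign: "\<epsilon> * \<epsilon> = 1"
    and equivariant: "x \<in> system T c \<Longrightarrow> F (shift 1 x) = shift \<epsilon> (F x)"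
begin

lemma equivariant_shift:
  assumes "x \<in> system T c"
  shows "F (shift k x) = shift (\<epsilon> * k) (F x)"
proof (induction k rule: int_induct[where k = 0])
  case (step1 i)
  have "F (shift (i + 1) x) = shift \<epsilon> (F (shift i x))"
    using equivariant[OF shift_in_system[OF assms], of i] by (simp add: add.commute)
  then show ?case using step1 by (simp add: algebra_simps)
next
  case (step2 i)
  have "shift (- \<epsilon>) (F (shift 1 (shift (i - 1) x))) = F (shift (i - 1) x)"
    using equivariant[OF shift_in_system[OF assms], of "i - 1"] by simp
  moreover have "shift 1 (shift (i - 1) x) = shift i x" by simp
  ultimately have "F (shift (i - 1) x) = shift (- \<epsilon>) (F (shift i x))" by metis
  then show ?case using step2 by (simp add: algebra_simps)
qed simp

text \<open>The odometer point below the image of the base point; the image of its shift by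
  \<open>k\<close> lies over \<open>\<epsilon> * k + image_coords\<close>.\<close>

definition image_coords :: "nat \<Rightarrow> nat \<Rightarrow> int"
  where "image_coords = (SOME z. coherent z \<and>
    (\<forall>R n. \<exists>k. agree n (F (base_point T c)) (shift k (base_point T' c')) \<and>
      (\<forall>j\<le>R. \<forall>r\<le>R. modulus j r dvd k - z j r)))"

lemma image_coords:
  "coherent image_coords"
  "\<exists>k. agree n (F (base_point T c)) (shift k (base_point T' c')) \<and>
     (\<forall>j\<le>R. \<forall>r\<le>R. modulus j r dvd k - image_coords j r)"
proof -
  have "base_point T c \<in> system T c" using shift_base_point_in_system[of 0 T c] by simp
  then have "F (base_point T c) \<in> system T' c'" using maps_to by blast
  from someI_ex[OF odometer_coordinates[OF this], folded image_coords_def]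
  show "coherent image_coords"
    "\<exists>k. agree n (F (base_point T c)) (shift k (base_point T' c')) \<and>
     (\<forall>j\<le>R. \<forall>r\<le>R. modulus j r dvd k - image_coords j r)"
    by blast+
qed

text \<open>The row \<open>Inr (n, ws, vs)\<close> of \<open>F (base_point T c)\<close> is discontinuous along
  a coset of the odometer, while it is computed from finitely many rows of \<open>base_point T c\<close>. The
  coset contains a point \<open>d\<close> whose coordinates beyond \<open>n\<close> are independent of all
  centres, so one of these finitely many rows must be discontinuous at \<open>d\<close> because of its
  coordinates up to \<open>n\<close>.\<close>

lemma centre_matching:
  assumes adm: "admissible T' c' n ws vs"
  shows "\<exists>i n' ws' vs'. admissible T c n' ws' vs' \<and> n' \<le> n \<and>
    (\<forall>j\<le>n'. \<forall>r. modulus j r dvd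
      \<epsilon> * (centre n ws vs j r - image_coords j r) + i - centre n' ws' vs' j r)"
proof (rule ccontr)
  assume no: "\<not> ?thesis"
  define z where "z = image_coords"
  define \<alpha> where "\<alpha> = centre n ws vs"
  \<comment> \<open>Up to coordinate \<open>n\<close>, \<open>d\<close> solves
    \<open>\<epsilon> * d + z = \<alpha>\<close>, so its image \<open>e\<close> lies in the split
    coset. Beyond \<open>n\<close> it uses the series of the empty word, which no centre of level
    above \<open>n\<close> involves in coordinate \<open>Suc n\<close>.\<close>
  define d where "d j r = (if j \<le> n then \<epsilon> * (\<alpha> j r - z j r)
    else lacunary j (\<lambda>u. of_bool (u = [])) r)" for j r
  define e where "e j r = \<epsilon> * d j r + z j r" for j r
  let ?b = "base_point T c" and ?b' = "base_point T' c'"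
  let ?v = "Inr (n, ws, vs) :: row"
  have z: "coherent z" unfolding z_def by (rule image_coords)
  have coh_d: "coherent d"
    unfolding coherent_def
  proof (intro allI)
    fix j r
    have "modulus j r dvd \<epsilon> * ((\<alpha> j (Suc r) - \<alpha> j r) - (z j (Suc r) - z j r))"
      using z coherent_centre[of n ws vs] unfolding coherent_def \<alpha>_def
      by (blast intro: dvd_mult dvd_diff)
    then show "modulus j r dvd d j (Suc r) - d j r"
      unfolding d_def by (auto simp: algebra_simps lacunary_Suc)
  qed
  have coh_e: "coherent e"
    unfolding coherent_def
  proof (intro allI)
    fix j r
    have "modulus j r dvd \<epsilon> * (d j (Suc r) - d j r) + (z j (Suc r) - z j r)"
      using z coh_d unfolding coherent_def by (blast intro: dvd_mult dvd_add)
    then show "modulus j r dvd e j (Suc r) - e j r"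
      unfolding e_def by (simp add: algebra_simps)
  qed
  have e: "e j r = \<alpha> j r" if "j \<le> n" for j r
    unfolding e_def d_def using that sign by (simp flip: mult.assoc)
  have far: "\<exists>j\<le>n'. \<exists>r. \<not> modulus j r dvd d j r + l - centre n' ws' vs' j r"
    if "admissible T c n' ws' vs'" for l n' ws' vs'
  proof (cases "n' \<le> n")
    case True
    show ?thesis
    proof (rule ccontr)
      assume "\<not> ?thesis"
      then have "\<forall>j\<le>n'. \<forall>r. modulus j r dvd \<epsilon> * (\<alpha> j r - z j r) + l - centre n' ws' vs' j r"
        using True unfolding d_def by auto
      then show False using no that True unfolding \<alpha>_def z_def by blast
    qed
  next
    case False
    show ?thesis
    proof (rule ccontr)
      assume *: "\<not> ?thesis"
      let ?j = "Suc n"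
      let ?f = "\<lambda>u. of_bool (u = []) - coef n' ws' vs' ?j u"
      have "modulus ?j r dvd lacunary ?j ?f r + l" for r
      proof -
        have "modulus ?j r dvd d ?j r + l - centre n' ws' vs' ?j r" using * False by auto
        then show ?thesis by (simp add: d_def centre_def lacunary_diff algebra_simps)
      qed
      moreover have "\<bar>?f u\<bar> \<le> 2 + int (length ws') + int (length vs')" for u
        using abs_coef_le[of n' ws' vs' ?j u] by auto
      ultimately have "?f [] = 0" by (rule lacunary_independent(1))
      moreover have "[] \<notin> set (map (take ?j) ws')" "[] \<notin> set (map (take ?j) vs')"
        using that False unfolding admissible_def by force+
      then have "count_list (map (take ?j) ws') [] = 0" "count_list (map (take ?j) vs') [] = 0"
        by (simp_all only: count_list_0_iff not_False_eq_True)
      ultimately show False by (simp add: coef_def)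
    qed
  qed
  obtain m where m: "\<forall>x\<in>system T c. \<forall>y\<in>system T c. agree m x y \<longrightarrow>
      agree (Suc (to_nat (0 :: int, ?v))) (F x) (F y)"
    using compact_continuous_agree[OF cantor_subset.compact[OF cantor_subset_system] continuous] by blast
  obtain R where R: "\<And>k k'. (\<forall>j\<le>R. \<forall>r\<le>R. modulus j r dvd k - d j r \<and> modulus j r dvd k' - d j r) \<Longrightarrow>
      agree m (shift k ?b) (shift k' ?b)"
    using base_point_agree_near[OF far, where m = m] by blast
  have same: "F ?b (\<epsilon> * k, ?v) = F ?b (\<epsilon> * k', ?v)" if "agree m (shift k ?b) (shift k' ?b)" for k k'
  proof -
    have "F (shift k ?b) (0, ?v) = F (shift k' ?b) (0, ?v)"
      using m that shift_base_point_in_system agree_imp_eq by blast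
    then show ?thesis
      using equivariant_shift[of ?b] shift_base_point_in_system[of 0 T c] by simp
  qed
  have osc: "\<exists>k. (\<forall>j\<le>R. \<forall>r\<le>R. modulus j r dvd k - d j r) \<and> F ?b (\<epsilon> * k, ?v) = b" for b
  proof -
    obtain k0 s where k0: "depth_parity n e k0 = b" "\<not> modulus 0 s dvd k0 - e 0 s"
      "\<forall>j\<le>R. \<forall>r\<le>R. modulus j r dvd k0 - e j r"
      using depth_parity_oscillates[OF coh_e] by blast
    define R' where "R' = max R (max n s)"
    obtain h where h: "\<forall>j\<le>R'. \<forall>r\<le>R'. modulus j r dvd h - z j r"
      using coherent_approx[OF z] by blast
    \<comment> \<open>Since \<open>k0\<close> is close to \<open>e\<close> and \<open>h\<close> to
      \<open>z\<close>, \<open>k\<close> is close to \<open>d\<close>. The entry of the image at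
      \<open>\<epsilon> * k\<close> is then read at \<open>k0 + (h' - h)\<close>, where
      \<open>h'\<close> is close to \<open>z\<close> too, so it has the parity prescribed for
      \<open>k0\<close>.\<close>
    define k where "k = \<epsilon> * (k0 - h)"
    have ek: "\<epsilon> * k = k0 - h" unfolding k_def using sign by (simp flip: mult.assoc)
    have "modulus j r dvd k - d j r" if "j \<le> R" "r \<le> R" for j r
    proof -
      have "modulus j r dvd \<epsilon> * ((k0 - e j r) - (h - z j r))"
        by (intro dvd_mult dvd_diff[of _ "k0 - e j r" "h - z j r"])
          (use k0(3) h that in \<open>simp_all add: R'_def\<close>)
      also have "\<epsilon> * ((k0 - e j r) - (h - z j r)) = k - (\<epsilon> * \<epsilon>) * d j r"
        unfolding k_def e_def by (simp add: algebra_simps)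
      finally show ?thesis using sign by simp
    qed
    moreover have "F ?b (\<epsilon> * k, ?v) = b"
    proof -
      obtain h' where h': "agree (Suc (to_nat (\<epsilon> * k, ?v))) (F ?b) (shift h' ?b')"
        "\<forall>j\<le>R'. \<forall>r\<le>R'. modulus j r dvd h' - z j r"
        using image_coords(2) unfolding z_def by blast
      have "F ?b (\<epsilon> * k, ?v) = ?b' (\<epsilon> * k + h', ?v)"
        using agree_imp_eq[OF h'(1)] by simp
      also have "\<dots> = depth_parity n \<alpha> (k0 + (h' - h))"
        using adm by (simp add: ek \<alpha>_def algebra_simps)
      also have "\<dots> = depth_parity n e k0"
      proof (rule depth_parity_cong[symmetric, of 0 n s])
        fix i t assume it: "i \<le> n" "t \<le> s"
        then have "modulus i t dvd (h' - z i t) - (h - z i t)"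
          by (intro dvd_diff[of _ "h' - z i t" "h - z i t"]) (use h h'(2) it in \<open>simp_all add: R'_def\<close>)
        then show "modulus i t dvd k0 + (h' - h) - \<alpha> i t - (k0 - e i t)"
          using e[OF it(1)] by (simp add: algebra_simps)
      qed (use k0 in auto)
      finally show ?thesis using k0(1) by simp
    qed
    ultimately show ?thesis by blast
  qed
  obtain k where k: "\<forall>j\<le>R. \<forall>r\<le>R. modulus j r dvd k - d j r" "F ?b (\<epsilon> * k, ?v) = True"
    using osc[of True] by blast
  obtain k' where k': "\<forall>j\<le>R. \<forall>r\<le>R. modulus j r dvd k' - d j r" "F ?b (\<epsilon> * k', ?v) = False"
    using osc[of False] by blast
  have "agree m (shift k ?b) (shift k' ?b)" by (rule R) (use k k' in blast)
  then show False using same[of k k'] k k' by simp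
qed

end

section \<open>From combinations of words to an infinite branch\<close>

lemma count_list_take_eq:
  assumes ext: "\<And>a. count_list ws (u @ [a]) = count_list vs (u @ [a])"
    and len: "\<And>w. w \<in> set ws \<union> set vs \<Longrightarrow> length w = Suc n"
  shows "count_list (map (take n) ws) u = count_list (map (take n) vs) u"
proof -
  have size: "count_list (map (take n) xs) u = size (filter_mset (\<lambda>w. take n w = u) (mset xs))" for xs
    by (induction xs) auto
  have count: "count (mset xs) w = count_list xs w" for xs and w :: "'a list"
    by (induction xs) auto
  \<comment> \<open>The words of length \<open>Suc n\<close> with prefix \<open>u\<close> are its
    one-letter extensions. Comparing multisets avoids a sum over infinitely many letters.\<close>
  have "filter_mset (\<lambda>w. take n w = u) (mset ws) = filter_mset (\<lambda>w. take n w = u) (mset vs)"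
  proof (rule multiset_eqI)
    fix w
    have "count (mset ws) w = count (mset vs) w" if w: "take n w = u"
    proof (cases "length w = Suc n")
      case True
      then have "w = u @ [w ! n]" using w by (metis lessI take_Suc_conv_app_nth take_all_iff order_refl)
      then show ?thesis using ext[of "w ! n"] count by metis
    next
      case False
      then have "w \<notin># mset ws" "w \<notin># mset vs" using len by auto
      then show ?thesis by (simp only: not_in_iff)
    qed
    then show "count (filter_mset (\<lambda>w. take n w = u) (mset ws)) w =
        count (filter_mset (\<lambda>w. take n w = u) (mset vs)) w" by simp
  qed
  then show ?thesis using size by simp
qed

lemma ill_foundedI_extension:
  assumes "P 0 []" and P: "\<And>n u. P n u \<Longrightarrow> length u = n \<and> T u \<and> (\<exists>a. P (Suc n) (u @ [a]))"
  shows "ill_founded T"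
proof -
  have "\<exists>x. \<forall>n. P n (x n) \<and> (\<exists>a. x (Suc n) = x n @ [a])"
    by (rule dependent_nat_choice) (use assms in blast)+
  then obtain x where x: "\<And>n. P n (x n)" "\<And>n. \<exists>a. x (Suc n) = x n @ [a]" by blast
  have "map (\<lambda>n. last (x (Suc n))) [0..<n] = x n" for n
  proof (induction n)
    case 0
    show ?case using P[OF x(1)[of 0]] by simp
  next
    case (Suc n)
    then show ?case using x(2)[of n] by auto
  qed
  then have "T (map (\<lambda>n. last (x (Suc n))) [0..<n])" for n using P[OF x(1)[of n]] by simp
  then show ?thesis unfolding ill_founded_def by blast
qed

text \<open>The words \<open>u\<close> with nonzero coefficient in the finite combination of level \<open>n\<close> form
  a branch: since the combinations of consecutive levels agree, one of the extensions of \<open>u\<close> has a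
  nonzero coefficient as well.\<close>

lemma ill_founded_if_coherent_combinations:
  assumes adm: "\<And>n. 1 \<le> n \<Longrightarrow> admissible T 1 n (ws n) (vs n)"
    and coef: "\<And>n u. 1 \<le> n \<Longrightarrow> coef (Suc n) (ws (Suc n)) (vs (Suc n)) n u = coef n (ws n) (vs n) n u"
    and "T []"
  shows "ill_founded T"
proof -
  \<comment> \<open>Level \<open>0\<close> is exempt from the coefficient condition because
    coordinate \<open>0\<close> of \<open>coef\<close> only records the level.\<close>
  define P where "P n u \<longleftrightarrow> length u = n \<and> T u \<and> (n = 0 \<or> coef n (ws n) (vs n) n u \<noteq> 0)" for n u
  have len: "length w = n \<and> T w" if "1 \<le> n" "w \<in> set (ws n) \<union> set (vs n)" for n w
    using adm[OF that(1)] that(2) unfolding admissible_def by blast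
  have T: "T u" "length u = n" if "1 \<le> n" "coef n (ws n) (vs n) n u \<noteq> 0" for n u
  proof -
    have "u \<in> set (map (take n) (ws n)) \<union> set (map (take n) (vs n))"
    proof (rule ccontr)
      assume "\<not> ?thesis"
      then have "count_list (map (take n) (ws n)) u = 0" "count_list (map (take n) (vs n)) u = 0"
        by (simp_all only: count_list_0_iff Un_iff de_Morgan_disj not_False_eq_True)
      then show False using that by (simp add: coef_def)
    qed
    then obtain w where "w \<in> set (ws n) \<union> set (vs n)" "u = take n w" by auto
    then show "T u" "length u = n" using len[OF that(1)] by auto
  qed
  have step: "\<exists>a. P (Suc n) (u @ [a])" if P: "P n u" for n u
  proof (rule ccontr)
    assume no: "\<nexists>a. P (Suc n) (u @ [a])"
    have "count_list (map (take n) (ws (Suc n))) u = count_list (map (take n) (vs (Suc n))) u"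
    proof (rule count_list_take_eq)
      show "length w = Suc n" if "w \<in> set (ws (Suc n)) \<union> set (vs (Suc n))" for w
        using len that by simp
      fix a
      have id: "map (take (Suc n)) xs = xs" if "\<And>w. w \<in> set xs \<Longrightarrow> length w = Suc n" for xs :: "nat list list"
        using that by (intro map_idI) simp
      have "coef (Suc n) (ws (Suc n)) (vs (Suc n)) (Suc n) (u @ [a]) = 0"
      proof (rule ccontr)
        assume "coef (Suc n) (ws (Suc n)) (vs (Suc n)) (Suc n) (u @ [a]) \<noteq> 0"
        then have "P (Suc n) (u @ [a])" unfolding P_def using T[of "Suc n" "u @ [a]"] by simp
        then show False using no by blast
      qed
      moreover have "map (take (Suc n)) (ws (Suc n)) = ws (Suc n)" "map (take (Suc n)) (vs (Suc n)) = vs (Suc n)"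
        using len[of "Suc n"] by (auto intro!: id)
      ultimately show "count_list (ws (Suc n)) (u @ [a]) = count_list (vs (Suc n)) (u @ [a])"
        by (simp add: coef_def)
    qed
    moreover have "count_list (map (take n) (ws (Suc n))) u \<noteq> count_list (map (take n) (vs (Suc n))) u"
    proof (cases "n = 0")
      \<comment> \<open>The branch starts because the coefficient sum is \<open>1\<close>: the two
        lists differ in length by one.\<close>
      case True
      have "count_list (map (take 0) xs) [] = length xs" for xs :: "nat list list"
        by (induction xs) auto
      then show ?thesis
        using True P adm[of "Suc n"] unfolding P_def admissible_def by simp
    next
      case False
      then have "coef (Suc n) (ws (Suc n)) (vs (Suc n)) n u \<noteq> 0"
        using coef[of n u] P unfolding P_def by simp
      then show ?thesis using False by (simp add: coef_def)
    qed
    ultimately show False by simp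
  qed
  have "P 0 []" unfolding P_def using \<open>T []\<close> by simp
  then show ?thesis
    by (rule ill_foundedI_extension) (use step in \<open>auto simp: P_def\<close>)
qed

text \<open>Independence in coordinate \<open>0\<close> forces matched rows to have the same level,
  the sign to be \<open>1\<close> and the integer shift to be the same for all levels. The image
  coordinates, up to that shift, are then combinations of sum \<open>1\<close>, and independence in
  coordinate \<open>n\<close> makes consecutive levels compatible.\<close>

lemma equivariant_map_rigid:
  assumes "equivariant_map T T 0 1 F \<epsilon>" "T \<in> Trees"
  shows "\<epsilon> = 1" "ill_founded T"
proof -
  interpret equivariant_map T T 0 1 F \<epsilon> by fact
  let ?z = image_coords
  let ?lab = "\<lambda>n u. of_bool (u = replicate n (0::nat)) :: int"
  have lab: "centre n ws vs 0 r = lacunary 0 (?lab n) r" for n ws vs r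
    unfolding centre_def coef_def by simp
  obtain w0 where "T w0" using assms(2) by (auto simp: Trees_def is_tree_def)
  then have T0: "T []" using assms(2) by (auto simp: Trees_def is_tree_def)
  \<comment> \<open>The row of level \<open>0\<close> can only match a row of level
    \<open>0\<close>; it fixes the reference shift \<open>i0\<close>.\<close>
  then have "admissible T 1 0 [[]] []" by (simp add: admissible_def)
  from centre_matching[OF this] obtain i0 where
    i0: "\<And>r. modulus 0 r dvd \<epsilon> * (lacunary 0 (?lab 0) r - ?z 0 r) + i0 - lacunary 0 (?lab 0) r"
    unfolding lab[symmetric] by (auto simp: lab)
  have main: "\<epsilon> = 1 \<and> (\<exists>ws vs. admissible T 1 n ws vs \<and>
      (\<forall>j r. 1 \<le> j \<longrightarrow> j \<le> n \<longrightarrow> modulus j r dvd centre n ws vs j r - ?z j r + i0))" if n: "1 \<le> n" for n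
  proof -
    obtain s where s: "T s" "length s = n" using assms(2) by (auto simp: Trees_def)
    then have "admissible T 1 n [s] []" by (simp add: admissible_def)
    from centre_matching[OF this] obtain i n' ws' vs' where m: "admissible T 0 n' ws' vs'" "n' \<le> n"
      "\<And>j r. j \<le> n' \<Longrightarrow> modulus j r dvd \<epsilon> * (centre n [s] [] j r - ?z j r) + i - centre n' ws' vs' j r"
      by blast
    \<comment> \<open>Subtracting the relation of level \<open>0\<close> eliminates the unknown
      \<open>?z\<close>. The coefficient at \<open>replicate n 0\<close> is then
      \<open>\<epsilon>\<close> minus the indicator of \<open>n' = n\<close>.\<close>
    let ?f = "\<lambda>u. (\<epsilon> * (?lab n u - ?lab 0 u)) - (?lab n' u - ?lab 0 u)"
    have "modulus 0 r dvd lacunary 0 ?f r + (i - i0)" for r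
    proof -
      have "modulus 0 r dvd \<epsilon> * (lacunary 0 (?lab n) r - ?z 0 r) + i - lacunary 0 (?lab n') r"
        using m(3)[of 0 r] by (simp only: lab le0 simp_thms)
      from dvd_diff[OF this i0[of r]] show ?thesis
        unfolding lacunary_diff lacunary_mult by (simp add: algebra_simps)
    qed
    moreover have "\<bar>?f u\<bar> \<le> 2 * \<bar>\<epsilon>\<bar> + 2" for u by (auto simp: of_bool_def)
    ultimately have f: "?f u = 0" and "i - i0 = 0" for u
      using lacunary_independent[of 0 ?f "i - i0" "2 * \<bar>\<epsilon>\<bar> + 2"] by blast+
    have "replicate n (0::nat) \<noteq> []" using n by auto
    then have "\<epsilon> = of_bool (replicate n (0::nat) = replicate n' 0)"
      using f[of "replicate n 0"] by simp
    also have "\<dots> = of_bool (n = n')" by simp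
    finally have "\<epsilon> = 1" "n' = n" using sign by (auto split: if_splits simp: of_bool_def)
    have "modulus j r dvd centre n (s # vs') ws' j r - ?z j r + i0" if "1 \<le> j" "j \<le> n" for j r
    proof -
      \<comment> \<open>Subtracting a combination of sum \<open>0\<close> from the single word
        \<open>s\<close> exchanges the lists and yields sum \<open>1\<close>.\<close>
      have "(\<lambda>u. coef n (s # vs') ws' j u) = (\<lambda>u. coef n [s] [] j u - coef n ws' vs' j u)"
        using that by (auto simp: coef_def fun_eq_iff)
      then have "centre n (s # vs') ws' j r = centre n [s] [] j r - centre n ws' vs' j r"
        unfolding centre_def by (metis lacunary_diff)
      then have "centre n (s # vs') ws' j r - ?z j r + i0 =
          \<epsilon> * (centre n [s] [] j r - ?z j r) + i - centre n' ws' vs' j r"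
        using \<open>\<epsilon> = 1\<close> \<open>n' = n\<close> \<open>i - i0 = 0\<close> by simp
      then show ?thesis using m(3)[of j r] that \<open>n' = n\<close> by simp
    qed
    moreover have "admissible T 1 n (s # vs') ws'"
      using m(1) s \<open>n' = n\<close> unfolding admissible_def by auto
    ultimately show ?thesis using \<open>\<epsilon> = 1\<close> by blast
  qed
  then show "\<epsilon> = 1" by blast
  obtain ws vs where wv: "\<And>n. 1 \<le> n \<Longrightarrow> admissible T 1 n (ws n) (vs n)"
    "\<And>n j r. 1 \<le> n \<Longrightarrow> 1 \<le> j \<Longrightarrow> j \<le> n \<Longrightarrow> modulus j r dvd centre n (ws n) (vs n) j r - ?z j r + i0"
    using main by metis
  show "ill_founded T"
  proof (rule ill_founded_if_coherent_combinations[OF wv(1) _ T0])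
    fix n u assume n: "1 \<le> (n::nat)"
    let ?f = "\<lambda>u. coef (Suc n) (ws (Suc n)) (vs (Suc n)) n u - coef n (ws n) (vs n) n u"
    let ?B = "\<lambda>n. 1 + int (length (ws n)) + int (length (vs n))"
    have "modulus n r dvd lacunary n ?f r + 0" for r
    proof -
      have "modulus n r dvd (centre (Suc n) (ws (Suc n)) (vs (Suc n)) n r - ?z n r + i0)
          - (centre n (ws n) (vs n) n r - ?z n r + i0)"
        using n by (intro dvd_diff[OF wv(2) wv(2)]) auto
      then show ?thesis unfolding lacunary_diff centre_def by (simp add: algebra_simps)
    qed
    moreover have "\<bar>?f u\<bar> \<le> ?B (Suc n) + ?B n" for u
      using abs_coef_le[of "Suc n" "ws (Suc n)" "vs (Suc n)" n u] abs_coef_le[of n "ws n" "vs n" n u]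
      by linarith
    ultimately have "?f u = 0" by (rule lacunary_independent(1))
    then show "coef (Suc n) (ws (Suc n)) (vs (Suc n)) n u = coef n (ws n) (vs n) n u" by simp
  qed
qed

section \<open>Conjugacies from branches\<close>

definition relabel :: "(row \<Rightarrow> row) \<Rightarrow> point \<Rightarrow> point"
  where "relabel f x = (\<lambda>(k, v). x (k, f v))"

lemma relabel_apply [simp]: "relabel f x (k, v) = x (k, f v)"
  by (simp add: relabel_def)

lemma shift_relabel: "relabel f (shift l x) = shift l (relabel f x)"
  by (simp add: relabel_def shift_def split_beta)

lemma agree_relabel: "\<exists>m. \<forall>x y. agree m x y \<longrightarrow> agree n (relabel f x) (relabel f y)"
proof -
  let ?W = "(\<lambda>i. (fst (from_nat i :: int \<times> row), f (snd (from_nat i :: int \<times> row)))) ` {..<n}"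
  have "finite ?W" by simp
  from agree_finite[OF this] obtain m where
    m: "\<forall>x y :: point. agree m x y \<longrightarrow> (\<forall>v\<in>?W. x v = y v)" by blast
  have "agree n (relabel f x) (relabel f y)" if "agree m x y" for x y
    unfolding agree_def
  proof (intro allI impI)
    fix i assume "i < n"
    then have "(fst (from_nat i :: int \<times> row), f (snd (from_nat i :: int \<times> row))) \<in> ?W" by blast
    then have "x (fst (from_nat i :: int \<times> row), f (snd (from_nat i :: int \<times> row))) =
        y (fst (from_nat i :: int \<times> row), f (snd (from_nat i :: int \<times> row)))"
      by (rule m[rule_format, OF that])
    then show "relabel f x (from_nat i) = relabel f y (from_nat i)"
      by (simp add: relabel_def split_beta)
  qed
  then show ?thesis by blast
qed

lemma continuous_on_relabel: "continuous_on A (relabel f)"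
proof (rule continuous_on_agreeI)
  fix x n
  show "\<exists>m. \<forall>y\<in>A. agree m x y \<longrightarrow> agree n (relabel f x) (relabel f y)"
    using agree_relabel[of n f] by blast
qed

text \<open>Changing rows by \<open>f\<close> realises the rotation by \<open>z\<close>: each row of
  the relabelled point equals that of an integer shift by \<open>k\<close> once \<open>k\<close> is
  close enough to \<open>z\<close>.\<close>

lemma relabel_base_point_in_system:
  assumes z: "coherent z"
    and Inl: "\<And>j r i. f (Inl (j, r, i)) = Inl (j, r, i - z j r)"
    and Inr: "\<And>n ws vs. f (Inr (n, ws, vs)) = Inr (n, g n ws vs, h n ws vs)"
    and adm: "\<And>n ws vs. admissible T c n (g n ws vs) (h n ws vs) = admissible T c' n ws vs"
    and centre: "\<And>n ws vs j r. j \<le> n \<Longrightarrow>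
      centre n (g n ws vs) (h n ws vs) j r = centre n ws vs j r - z j r"
  shows "relabel f (base_point T c) \<in> system T c'"
  unfolding mem_system_iff
proof
  fix n
  let ?x = "relabel f (base_point T c)" and ?b = "base_point T c'"
  let ?near = "\<lambda>R k. \<forall>j\<le>R. \<forall>r\<le>R. modulus j r dvd k - z j r"
  have "\<exists>R. \<forall>x y. (\<exists>k. ?near R k \<and> x = ?x \<and> y = shift k ?b) \<longrightarrow> agree n x y"
  proof (rule agree_uniform)
    fix p :: "int \<times> row"
    obtain l v where p: "p = (l, v)" by fastforce
    have "\<exists>R. \<forall>k. ?near R k \<longrightarrow> base_point T c (l, f v) = ?b (l + k, v)"
    proof (cases v)
      case (Inl a)
      obtain j r i where a: "a = (j, r, i)" by (cases a)
      have "base_point T c (l, f v) = ?b (l + k, v)" if "?near (max j r) k" for k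
      proof -
        have "modulus j r dvd k - z j r" using that by simp
        then have "modulus j r dvd (l + k - i) - (l - (i - z j r))" by (simp add: algebra_simps)
        from dvd_iff_if_dvd_diff[OF this] show ?thesis by (simp add: Inl a assms(2))
      qed
      then show ?thesis by blast
    next
      case (Inr a)
      obtain m ws vs where a: "a = (m, ws, vs)" by (cases a)
      obtain r where r: "\<not> modulus 0 r dvd l - centre m (g m ws vs) (h m ws vs) 0 r"
        using centre_not_integer by blast
      have "base_point T c (l, f v) = ?b (l + k, v)" if near: "?near (max m r) k" for k
      proof -
        have "depth_parity m (centre m (g m ws vs) (h m ws vs)) l = depth_parity m (centre m ws vs) (l + k)"
        proof (rule depth_parity_cong[of 0 m r l "centre m (g m ws vs) (h m ws vs)"])
          fix i s assume "i \<le> m" "s \<le> r"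
          moreover from this have "modulus i s dvd k - z i s" using near by simp
          ultimately show "modulus i s dvd (l + k - centre m ws vs i s) -
              (l - centre m (g m ws vs) (h m ws vs) i s)"
            by (simp add: centre algebra_simps)
        qed (use r in simp_all)
        then show ?thesis by (simp add: Inr a assms(3) adm)
      qed
      then show ?thesis by blast
    qed
    then obtain R where R: "\<forall>k. ?near R k \<longrightarrow> base_point T c (l, f v) = ?b (l + k, v)" ..
    have "?x p = shift k ?b p" if "?near R k" for k
      unfolding p relabel_apply shift_apply by (rule R[rule_format]) (use that in blast)
    then show "\<exists>R. \<forall>x y. (\<exists>k. ?near R k \<and> x = ?x \<and> y = shift k ?b) \<longrightarrow> x p = y p"
      by blast
  next
    fix R R' :: nat and x y assume "R \<le> R'" "\<exists>k. ?near R' k \<and> x = ?x \<and> y = shift k ?b"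
    moreover from this obtain k where "x = ?x" "y = shift k ?b" "?near R' k" by blast
    ultimately show "\<exists>k. ?near R k \<and> x = ?x \<and> y = shift k ?b"
      by (intro exI[of _ k]) simp
  qed
  then obtain R where R: "\<forall>x y. (\<exists>k. ?near R k \<and> x = ?x \<and> y = shift k ?b) \<longrightarrow> agree n x y" ..
  obtain k where "?near R k" using coherent_approx[OF z] by blast
  then have "agree n ?x (shift k ?b)" by (intro R[rule_format] exI[of _ k]) simp
  then show "\<exists>k. agree n ?x (shift k ?b)" ..
qed

lemma relabel_maps_system:
  assumes "relabel f (base_point T c) \<in> system T c'" "x \<in> system T c"
  shows "relabel f x \<in> system T c'"
proof -
  have "relabel f x \<in> closure (system T c')"
    unfolding closure_agree_iff
  proof
    fix n
    obtain m where m: "\<forall>x y. agree m x y \<longrightarrow> agree n (relabel f x) (relabel f y)"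
      using agree_relabel[of n f] ..
    obtain k where "agree m x (shift k (base_point T c))" using assms(2) mem_system_iff by blast
    then have "agree n (relabel f x) (shift k (relabel f (base_point T c)))"
      using m by (simp add: shift_relabel[symmetric])
    then show "\<exists>a\<in>system T c'. agree n (relabel f x) a" using shift_in_system assms(1) by blast
  qed
  then show ?thesis by (simp add: system_def)
qed

text \<open>The composite of \<open>f\<close> and \<open>g\<close> may rename rows; it only has to
  preserve the contents of rows of the base point, which passes to the orbit closure.\<close>

lemma relabel_relabel_system:
  assumes inv: "\<And>k v. base_point T c (k, f (g v)) = base_point T c (k, v)" and x: "x \<in> system T c"
  shows "relabel g (relabel f x) = x"
proof
  fix p :: "int \<times> row"
  obtain l v where p: "p = (l, v)" by fastforce
  have "finite {(l, v), (l, f (g v))}" by simp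
  from agree_finite[OF this] obtain m where
    m: "\<forall>x y :: point. agree m x y \<longrightarrow> (\<forall>p\<in>{(l, v), (l, f (g v))}. x p = y p)" by blast
  obtain k where "agree m x (shift k (base_point T c))" using x mem_system_iff by blast
  from m[rule_format, OF this] inv show "relabel g (relabel f x) p = x p" by (simp add: p)
qed

text \<open>An infinite branch \<open>w\<close> yields the element of the odometer with coordinates
  \<open>u (map w [0..<j])\<close>; the rotation by it matches the centres of the two systems.\<close>

lemma systems_homeomorphic_if_ill_founded:
  assumes "ill_founded T"
  shows "\<exists>F G. homeomorphism (system T 0) (system T 1) F G \<and> (\<forall>x. F (shift 1 x) = shift 1 (F x))"
proof -
  obtain w where w: "\<And>n. T (map w [0..<n])" using assms unfolding ill_founded_def by blast
  define pre where "pre n = map w [0..<n]" for n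
  \<comment> \<open>Coordinate \<open>0\<close> of the rotation is zero, since there a centre
    depends on its level alone.\<close>
  define b where "b j u = (of_bool (j \<noteq> 0 \<and> u = pre j) :: int)" for j u
  define z where "z j = lacunary j (b j)" for j
  \<comment> \<open>Rows of the second system are read from rows of the first: adding the branch
    prefix to the subtracted words lowers the sum from \<open>1\<close> to \<open>0\<close>.\<close>
  define f :: "row \<Rightarrow> row" where "f v = (case v of Inl (j, r, i) \<Rightarrow> Inl (j, r, i - z j r)
    | Inr (n, ws, vs) \<Rightarrow> Inr (n, ws, pre n # vs))" for v
  define g :: "row \<Rightarrow> row" where "g v = (case v of Inl (j, r, i) \<Rightarrow> Inl (j, r, i - (- z j r))
    | Inr (n, ws, vs) \<Rightarrow> Inr (n, pre n # ws, vs))" for v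
  have T: "T (pre n)" "length (pre n) = n" for n using w by (simp_all add: pre_def)
  have take: "take j (pre n) = pre j" if "j \<le> n" for j n
    using that by (simp add: pre_def take_map)
  have z: "coherent z" unfolding z_def by (rule coherent_lacunary)
  then have z': "coherent (\<lambda>j r. - z j r)"
    unfolding coherent_def by (metis dvd_minus_iff minus_diff_minus)
  have cf: "centre n ws (pre n # vs) j r = centre n ws vs j r - z j r" if "j \<le> n" for n ws vs j r
  proof -
    have "coef n ws (pre n # vs) j = (\<lambda>u. coef n ws vs j u - b j u)"
      using take[OF that] by (auto simp: coef_def b_def fun_eq_iff)
    then show ?thesis unfolding centre_def z_def by (simp only: lacunary_diff)
  qed
  have cg: "centre n (pre n # ws) vs j r = centre n ws vs j r - - z j r" if "j \<le> n" for n ws vs j r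
  proof -
    have "coef n (pre n # ws) vs j = (\<lambda>u. coef n ws vs j u + b j u)"
      using take[OF that] by (auto simp: coef_def b_def fun_eq_iff)
    then show ?thesis unfolding centre_def z_def by (simp only: lacunary_add diff_minus_eq_add)
  qed
  \<comment> \<open>Going back and forth adds the prefix to both lists; the row is renamed, but the
    two contributions to its centre cancel.\<close>
  have cfg: "depth_parity n (centre n (pre n # ws) (pre n # vs)) = depth_parity n (centre n ws vs)" for n ws vs
    unfolding depth_parity_def by (auto simp: fun_eq_iff cf cg cong: conj_cong)
  have F: "relabel f (base_point T 0) \<in> system T 1"
    by (rule relabel_base_point_in_system[OF z, where g = "\<lambda>n ws vs. ws" and h = "\<lambda>n ws vs. pre n # vs"])
       (auto simp: f_def cf admissible_def T)
  have G: "relabel g (base_point T 1) \<in> system T 0"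
    by (rule relabel_base_point_in_system[OF z', where g = "\<lambda>n ws vs. pre n # ws" and h = "\<lambda>n ws vs. vs"])
       (auto simp: g_def cg admissible_def T)
  have fg: "base_point T c (k, f (g v)) = base_point T c (k, v)"
    "base_point T c (k, g (f v)) = base_point T c (k, v)" for c k v
    by (auto simp: f_def g_def cfg admissible_def T split: sum.split)
  have "homeomorphism (system T 0) (system T 1) (relabel f) (relabel g)"
  proof (rule homeomorphismI)
    show "relabel f ` system T 0 \<subseteq> system T 1" "relabel g ` system T 1 \<subseteq> system T 0"
      using relabel_maps_system F G by blast+
    show "relabel g (relabel f x) = x" if "x \<in> system T 0" for x
      by (rule relabel_relabel_system[of T 0 f g, OF _ that]) (rule fg)
    show "relabel f (relabel g x) = x" if "x \<in> system T 1" for x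
      by (rule relabel_relabel_system[of T 1 g f, OF _ that]) (rule fg)
  qed (rule continuous_on_relabel)+
  then show ?thesis using shift_relabel by blast
qed

section \<open>The reduction\<close>

lemma conjugate_coded_mapI:
  assumes P: "cantor_subset P" and Q: "cantor_subset Q" and SP: "S ` P \<subseteq> P"
    and F: "homeomorphism P Q F G" and eq: "\<And>x. x \<in> P \<Longrightarrow> F (S x) = S' (F x)"
  shows "conjugate (coded_map P S) (coded_map Q S')"
proof -
  interpret P: cantor_subset P by fact
  interpret Q: cantor_subset Q by fact
  let ?p = "inv_into P (code P)"
  define \<phi> where "\<phi> = code Q \<circ> F \<circ> ?p"
  have "homeomorphism UNIV P ?p (code P)"
    using P.homeomorphism_code by (rule homeomorphism_symD)
  from homeomorphism_compose[OF this homeomorphism_compose[OF F Q.homeomorphism_code]]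
  have "\<phi> \<in> Homeo" unfolding Homeo_def \<phi>_def by (auto simp: comp_assoc)
  moreover have "\<phi> \<circ> coded_map P S = coded_map Q S' \<circ> \<phi>"
  proof
    fix b
    have p: "?p b \<in> P" using P.homeomorphism_code by (auto simp: homeomorphism_def)
    then have "S (?p b) \<in> P" "F (?p b) \<in> Q" using SP F by (auto simp: homeomorphism_def)
    then show "(\<phi> \<circ> coded_map P S) b = (coded_map Q S' \<circ> \<phi>) b"
      using eq[OF p] by (simp add: \<phi>_def coded_map_def inv_into_f_f P.inj_on_code Q.inj_on_code)
  qed
  ultimately show ?thesis unfolding conjugate_def by blast
qed

lemma conjugate_coded_mapD:
  assumes P: "cantor_subset P" and Q: "cantor_subset Q" and SP: "S ` P \<subseteq> P" and SQ: "S' ` Q \<subseteq> Q"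
    and conj: "conjugate (coded_map P S) (coded_map Q S')"
  shows "\<exists>F. continuous_on P F \<and> F ` P \<subseteq> Q \<and> (\<forall>x\<in>P. F (S x) = S' (F x))"
proof -
  interpret P: cantor_subset P by fact
  interpret Q: cantor_subset Q by fact
  let ?q = "inv_into Q (code Q)"
  obtain \<phi> where \<phi>: "\<phi> \<in> Homeo" "\<phi> \<circ> coded_map P S = coded_map Q S' \<circ> \<phi>"
    using conj unfolding conjugate_def by blast
  then obtain \<psi> where \<psi>: "homeomorphism UNIV UNIV \<phi> \<psi>" unfolding Homeo_def by blast
  have "homeomorphism UNIV Q ?q (code Q)"
    using Q.homeomorphism_code by (rule homeomorphism_symD)
  from homeomorphism_compose[OF homeomorphism_compose[OF P.homeomorphism_code \<psi>] this]
  have F: "\<exists>G. homeomorphism P Q (?q \<circ> \<phi> \<circ> code P) G" by (auto simp: comp_assoc)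
  have "(?q \<circ> \<phi> \<circ> code P) (S x) = S' ((?q \<circ> \<phi> \<circ> code P) x)" if x: "x \<in> P" for x
  proof -
    let ?y = "?q (\<phi> (code P x))"
    have y: "?y \<in> Q" using Q.homeomorphism_code by (auto simp: homeomorphism_def)
    have "\<phi> (code P (S x)) = code Q (S' ?y)"
      using fun_cong[OF \<phi>(2), of "code P x"] x
      by (simp add: coded_map_def inv_into_f_f P.inj_on_code)
    then have "?q (\<phi> (code P (S x))) = S' ?y"
      using y SQ by (auto simp: inv_into_f_f Q.inj_on_code)
    then show ?thesis by simp
  qed
  then show ?thesis using F by (intro exI[of _ "?q \<circ> \<phi> \<circ> code P"]) (auto simp: homeomorphism_def)
qed

definition cantor_system :: "nat \<Rightarrow> (nat list \<Rightarrow> bool) \<Rightarrow> cantor \<Rightarrow> cantor"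
  where "cantor_system c T = coded_map (system T c) (shift 1)"

lemma shift_image_system: "shift l ` system T c \<subseteq> system T c"
  using shift_in_system by blast

lemma cantor_system_Min_Homeo: "cantor_system c T \<in> Min_Homeo"
  unfolding cantor_system_def
  by (rule coded_map_Min_Homeo[OF cantor_subset_system homeomorphism_shift system_dense_orbit])

lemma inv_cantor_system: "inv (cantor_system c T) = coded_map (system T c) (shift (- 1))"
  unfolding cantor_system_def
  by (rule coded_map_Homeo(2)[OF cantor_subset_system homeomorphism_shift])

text \<open>Finitely many words fix the prefixes of the system up to a given length, and these fix
  the coded map up to a given uniform error.\<close>

lemma continuous_map_cantor_system:
  "continuous_map (top_of_set A) min_topology (cantor_system c)"
proof -
  interpret H: Metric_space Homeo sup_dist by (rule Metric_space_Homeo)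
  have "continuous_map (top_of_set A) H.mtopology (cantor_system c)"
    unfolding H.continuous_map_to_metric
  proof (intro ballI allI impI)
    fix T and e :: real assume T: "T \<in> topspace (top_of_set A)" and "0 < e"
    then obtain N where N: "\<forall>x y :: cantor. agree N x y \<longrightarrow> dist x y < e / 2"
      using dist_less_if_agree[of "e / 2"] by auto
    have "\<exists>m. \<forall>x y. agree m x y \<longrightarrow> agree n (shift 1 x) (shift 1 y)" for n
      using agree_shift[of "{1}" n] by auto
    from coded_map_agree[OF cantor_subset_system shift_image_system this]
    obtain M where M: "\<And>T'. same_prefixes M (system T c) (system T' c) \<Longrightarrow>
        agree N (cantor_system c T b) (cantor_system c T' b)" for b
      unfolding cantor_system_def using cantor_subset_system shift_image_system by metis
    obtain D where D: "finite D" "\<And>T'. \<forall>w\<in>D. T' w = T w \<Longrightarrow> same_prefixes M (system T c) (system T' c)"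
      using same_prefixes_system by blast
    define U where "U = A \<inter> {T'. \<forall>w\<in>D. T' w = T w}"
    have "cantor_system c T' \<in> H.mball (cantor_system c T) e" if "T' \<in> U" for T'
    proof -
      have "same_prefixes M (system T c) (system T' c)" using D(2) that unfolding U_def by blast
      then have "dist (cantor_system c T b) (cantor_system c T' b) \<le> e / 2" for b
        using M N by (meson less_imp_le)
      then have "sup_dist (cantor_system c T) (cantor_system c T') \<le> e / 2"
        unfolding sup_dist_def by (intro cSUP_least) auto
      then show ?thesis
        using \<open>0 < e\<close> cantor_system_Min_Homeo unfolding Min_Homeo_def by (auto simp: H.in_mball)
    qed
    moreover have "openin (top_of_set A) U"
    proof -
      obtain m where m: "\<forall>x y. agree m x y \<longrightarrow> (\<forall>w\<in>D. x w = y w)"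
        using agree_finite[OF D(1)] by blast
      have "closed {T'. \<not> (\<forall>w\<in>D. T' w = T w)}"
        by (rule closed_agree[of m]) (use m in metis)
      then have "open {T'. \<forall>w\<in>D. T' w = T w}" by (simp only: closed_def Collect_neg_eq double_compl)
      then show ?thesis unfolding U_def by (simp add: openin_open_Int)
    qed
    moreover have "T \<in> U" using T by (simp add: U_def)
    ultimately show "\<exists>U. openin (top_of_set A) U \<and> T \<in> U \<and>
        (\<forall>y\<in>U. cantor_system c y \<in> H.mball (cantor_system c T) e)" by blast
  qed
  then show ?thesis
    unfolding min_topology_def homeo_topology_def continuous_map_in_subtopology
    using cantor_system_Min_Homeo by blast
qed

lemma conjugate_cantor_systems_rigid:
  assumes "T \<in> Trees" "\<epsilon> = 1 \<or> \<epsilon> = - 1"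
    and "conjugate (cantor_system 0 T) (coded_map (system T 1) (shift \<epsilon>))"
  shows "\<epsilon> = 1 \<and> ill_founded T"
proof -
  obtain F where F: "continuous_on (system T 0) F" "F ` system T 0 \<subseteq> system T 1"
    "\<forall>x\<in>system T 0. F (shift 1 x) = shift \<epsilon> (F x)"
    using conjugate_coded_mapD[OF cantor_subset_system cantor_subset_system
        shift_image_system shift_image_system assms(3)[unfolded cantor_system_def]] by blast
  have "equivariant_map T T 0 1 F \<epsilon>"
    using F assms(2) by unfold_locales auto
  then show ?thesis using equivariant_map_rigid assms(1) by blast
qed

theorem theorem1p1:
  shows "\<exists>\<Phi>\<^sub>1 \<Phi>\<^sub>2 :: (nat list \<Rightarrow> bool) \<Rightarrow> cantor \<Rightarrow> cantor.
    continuous_map (top_of_set Trees) (prod_topology min_topology min_topology) (\<lambda>T. (\<Phi>\<^sub>1 T, \<Phi>\<^sub>2 T)) \<and>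
    (\<forall>T\<in>Trees.
      (ill_founded T \<longrightarrow> conjugate (\<Phi>\<^sub>1 T) (\<Phi>\<^sub>2 T)) \<and>
      (well_founded T \<longrightarrow> \<not> conjugate (\<Phi>\<^sub>1 T) (\<Phi>\<^sub>2 T) \<and> \<not> conjugate (\<Phi>\<^sub>1 T) (inv (\<Phi>\<^sub>2 T))))"
proof (rule exI[of _ "cantor_system 0"], rule exI[of _ "cantor_system 1"], intro conjI ballI impI)
  show "continuous_map (top_of_set Trees) (prod_topology min_topology min_topology)
      (\<lambda>T. (cantor_system 0 T, cantor_system 1 T))"
    by (simp add: continuous_map_paired continuous_map_cantor_system)
next
  fix T assume "ill_founded T"
  then obtain F G where "homeomorphism (system T 0) (system T 1) F G" "\<forall>x. F (shift 1 x) = shift 1 (F x)"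
    using systems_homeomorphic_if_ill_founded by blast
  then show "conjugate (cantor_system 0 T) (cantor_system 1 T)"
    unfolding cantor_system_def
    by (intro conjugate_coded_mapI[of "system T 0" "system T 1" "shift 1" F G]
        cantor_subset_system shift_image_system) auto
next
  fix T assume T: "T \<in> Trees" "well_founded T"
  show "\<not> conjugate (cantor_system 0 T) (cantor_system 1 T)"
    using conjugate_cantor_systems_rigid[OF T(1), of 1] T(2) unfolding cantor_system_def by blast
  \<comment> \<open>A conjugacy with the inverse would be the case \<open>\<epsilon> = - 1\<close>,
    against the conclusion \<open>\<epsilon> = 1\<close> of rigidity.\<close>
  show "\<not> conjugate (cantor_system 0 T) (inv (cantor_system 1 T))"
    using conjugate_cantor_systems_rigid[OF T(1), of "- 1"] unfolding inv_cantor_system by force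
qed

end
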